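(* There exists $A\subset\mathbb{P}$ such that $d_{\mathbb{P}}(A)=1$ and $A-A$ is not syndetic. In particular, $R=\mathbb{N}\setminus(A-A)$ is a thick set (and so an intersective set) but not a prime intersective set.
   Context: $\mathbb{N}=\{1,2,3,\dots\}$, $[N]=\{1,\dots,N\}$, $\mathbb{P}$ is the set of primes. For $A,E\subset\mathbb{N}$, $E$ infinite, $\overline{d}_E(A)=\limsup_{N\to\infty}\frac{|A\cap E\cap[N]|}{|E\cap[N]|}$ and $\underline{d}_E(A)=\liminf_{N\to\infty}\frac{|A\cap E\cap[N]|}{|E\cap[N]|}$; if they are equal, the common value is $d_E(A)$. $A-B=\{a-b:a\in A,b\in B\}$. A set $S\subset\mathbb{N}$ is thick if it contains arbitrarily long intervals $\{m,m+1,\dots,m+n\}$; it is syndetic if $S-F\supset\mathbb{N}$ for some finite set $F$ (equivalently gaps between consecutive elements are bounded). A set $S\subset\mathbb{Z}$ is called thick/syndetic if $S\cap\mathbb{N}$ is. For infinite $E\subset\mathbb{N}$, $R\subset\mathbb{N}$ is $E$-intersective if for every $A\subset E$ with $\overline{d}_E(A)>0$ we have $R\cap(A-A)\neq\varnothing$; intersective means $\mathbb{N}$-intersective and prime intersective means $\mathbb{P}$-intersective. *)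

theory Defs
  imports Complex_Main "HOL-Library.Extended_Real" "HOL-Library.Liminf_Limsup"
    "HOL-Computational_Algebra.Primes"
begin

text \<open>
  All sets are sets of integers, so that differences need no coercions. The natural numbers
  start at 1, and primes of type \<^typ>\<open>int\<close> are positive.
\<close>

definition Npos :: "int set" where
  "Npos = {1..}"

definition Primes :: "int set" where
  "Primes = {p. prime p}"

definition diff_set :: "int set \<Rightarrow> int set \<Rightarrow> int set" where
  "diff_set A B = {a - b | a b. a \<in> A \<and> b \<in> B}"

text \<open>The relative densities are meant for infinite \<open>E \<subseteq> Npos\<close>; then the quotient by zero
  occurs for finitely many \<open>N\<close> only.\<close>

definition rel_freq :: "int set \<Rightarrow> int set \<Rightarrow> nat \<Rightarrow> real" where
  "rel_freq E A N = real (card (A \<inter> E \<inter> {1..int N})) / real (card (E \<inter> {1..int N}))"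

definition upper_rel_density :: "int set \<Rightarrow> int set \<Rightarrow> ereal" where
  "upper_rel_density E A = limsup (\<lambda>N. ereal (rel_freq E A N))"

definition lower_rel_density :: "int set \<Rightarrow> int set \<Rightarrow> ereal" where
  "lower_rel_density E A = liminf (\<lambda>N. ereal (rel_freq E A N))"

definition has_rel_density :: "int set \<Rightarrow> int set \<Rightarrow> real \<Rightarrow> bool" where
  "has_rel_density E A d \<longleftrightarrow>
     upper_rel_density E A = ereal d \<and> lower_rel_density E A = ereal d"

definition thick :: "int set \<Rightarrow> bool" where
  "thick S \<longleftrightarrow> (\<forall>n::nat. \<exists>m. {m..m + int n} \<subseteq> S \<inter> Npos)"

definition syndetic :: "int set \<Rightarrow> bool" where
  "syndetic S \<longleftrightarrow> (\<exists>F. finite F \<and> Npos \<subseteq> diff_set (S \<inter> Npos) F)"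

definition intersective_wrt :: "int set \<Rightarrow> int set \<Rightarrow> bool" where
  "intersective_wrt E R \<longleftrightarrow>
     (\<forall>A. A \<subseteq> E \<and> upper_rel_density E A > 0 \<longrightarrow> R \<inter> diff_set A A \<noteq> {})"

definition intersective :: "int set \<Rightarrow> bool" where
  "intersective R \<longleftrightarrow> intersective_wrt Npos R"

definition prime_intersective :: "int set \<Rightarrow> bool" where
  "prime_intersective R \<longleftrightarrow> intersective_wrt Primes R"

end

theory Submission
  imports Defs "HOL-Number_Theory.Cong" "HOL-Number_Theory.Prime_Powers"
    "HOL-Analysis.Harmonic_Numbers" "HOL-Real_Asymp.Real_Asymp"
begin

text \<open>
  For a fixed \<open>h\<close>, the primes \<open>p\<close> with \<open>p - h\<close> prime have relative density zero in the primes.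
  This follows from Selberg's sieve, in which \<open>p\<close> avoids the class of \<open>0\<close> modulo all primes up to
  a power of \<open>N\<close>, and also the class of \<open>h\<close> modulo the primes of a finite set \<open>L\<close> of primes not
  dividing \<open>h\<close>; the second condition saves a factor \<open>\<Prod>l\<in>L. 1 + 1 / (l - 1)\<close>, which is as large as
  we please, and the bound is compared with Chebyshev's lower bound for the number of primes.

  The bound holds from some \<open>N0\<close> on which depends on \<open>L\<close> only. If \<open>L\<close> consists of primes above \<open>n\<close>
  and \<open>m\<close> is a multiple of their product, then no \<open>h \<in> {m<..m + n}\<close> is divisible by an
  element of \<open>L\<close>. Taking \<open>m \<ge> N0\<close>, the primes \<open>p\<close> for which \<open>p - h\<close> is prime for some such \<open>h\<close> make up
  at most the proportion \<open>1 / 2 ^ n\<close> of the primes up to \<open>N\<close>, for every \<open>N\<close>, because all of them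
  exceed \<open>m\<close>. Deleting these primes for all \<open>n\<close> leaves a set of relative density one
  whose differences miss all the intervals \<open>{m<..m + n}\<close>.
\<close>

section \<open>Selberg's sieve\<close>

lemma prod_one_plus:
  fixes f :: "'a \<Rightarrow> 'b :: comm_semiring_1"
  assumes "finite A"
  shows "(\<Prod>x\<in>A. 1 + f x) = (\<Sum>X\<in>Pow A. \<Prod>x\<in>X. f x)"
  using prod_add[OF assms, of f "\<lambda>_. 1"] by (simp add: add.commute)

text \<open>This is Moebius inversion on the subset lattice. Removing \<open>U\<close> leaves a
  signed sum over the subsets of \<open>X - U\<close>, which factors into terms
  \<open>1 + (-1)\<close> and vanishes unless \<open>X - U\<close> is empty.\<close>

lemma sum_alternating_between:
  fixes U X :: "'a set"
  assumes "finite X" "U \<subseteq> X"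
  shows "(\<Sum>S | U \<subseteq> S \<and> S \<subseteq> X. (-1) ^ card S) = (if U = X then (-1) ^ card U else (0 :: real))"
proof -
  have fU: "finite U" using assms finite_subset by blast
  have "(\<Sum>S | U \<subseteq> S \<and> S \<subseteq> X. (-1) ^ card S) = (\<Sum>B\<in>Pow (X - U). (-1) ^ card U * (\<Prod>x\<in>B. (-1 :: real)))"
  proof (rule sum.reindex_bij_witness[of _ "\<lambda>B. U \<union> B" "\<lambda>S. S - U"])
    fix S assume S: "S \<in> {S. U \<subseteq> S \<and> S \<subseteq> X}"
    then have "finite S" using assms finite_subset by auto
    then have "card S = card U + card (S - U)"
      using S fU by (simp add: card_Diff_subset card_mono)
    then show "(-1) ^ card U * (\<Prod>x\<in>S - U. (-1 :: real)) = (-1) ^ card S"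
      by (simp add: power_add)
  qed (use assms in auto)
  also have "\<dots> = (-1) ^ card U * (\<Prod>x\<in>X - U. 1 + (-1))"
    using assms by (subst prod_one_plus) (auto simp: sum_distrib_left)
  also have "\<dots> = (if U = X then (-1) ^ card U else 0)"
    using assms by (auto simp: power_0_left card_eq_0_iff)
  finally show ?thesis .
qed

text \<open>
  A squarefree number is encoded as its finite set of prime factors: divisibility becomes inclusion,
  lcm and gcd become union and intersection, and \<open>D\<close> is the set of squarefree numbers up to
  the sieve level.
\<close>

lemma selberg_diagonalization:
  fixes v :: "'a set \<Rightarrow> real" and k :: "'a \<Rightarrow> real"
  assumes fin: "finite D" and fin': "\<And>S. S \<in> D \<Longrightarrow> finite S"
    and down: "\<And>S T. S \<in> D \<Longrightarrow> T \<subseteq> S \<Longrightarrow> T \<in> D"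
  shows "(\<Sum>S\<in>D. \<Sum>T\<in>D. v S * v T * (\<Prod>p\<in>S \<inter> T. 1 + k p))
       = (\<Sum>U\<in>D. (\<Prod>p\<in>U. k p) * (\<Sum>S | S \<in> D \<and> U \<subseteq> S. v S)\<^sup>2)"
proof -
  \<comment> \<open>The product over \<open>S \<inter> T\<close> is expanded over its subsets
    \<open>U\<close>, all of which lie in \<open>D\<close> by downward closure. Once
    \<open>U\<close> is summed outermost, the sums over \<open>S\<close> and \<open>T\<close>
    separate into a square.\<close>
  have "(\<Sum>S\<in>D. \<Sum>T\<in>D. v S * v T * (\<Prod>p\<in>S \<inter> T. 1 + k p))
      = (\<Sum>S\<in>D. \<Sum>T\<in>D. \<Sum>U\<in>D. if U \<subseteq> S \<and> U \<subseteq> T then v S * v T * (\<Prod>p\<in>U. k p) else 0)"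
  proof (intro sum.cong refl)
    fix S T assume ST: "S \<in> D" "T \<in> D"
    have "v S * v T * (\<Prod>p\<in>S \<inter> T. 1 + k p) = (\<Sum>U\<in>Pow (S \<inter> T). v S * v T * (\<Prod>p\<in>U. k p))"
      using ST fin' by (subst prod_one_plus) (auto simp: sum_distrib_left)
    also have "Pow (S \<inter> T) = {U \<in> D. U \<subseteq> S \<and> U \<subseteq> T}"
      using ST down by auto
    finally show "v S * v T * (\<Prod>p\<in>S \<inter> T. 1 + k p) =
      (\<Sum>U\<in>D. if U \<subseteq> S \<and> U \<subseteq> T then v S * v T * (\<Prod>p\<in>U. k p) else 0)"
      using fin by (simp add: sum.inter_filter)
  qed
  also have "\<dots> = (\<Sum>U\<in>D. \<Sum>S\<in>D. \<Sum>T\<in>D. if U \<subseteq> S \<and> U \<subseteq> T then v S * v T * (\<Prod>p\<in>U. k p) else 0)"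
    by (subst (2) sum.swap, subst sum.swap, rule sum.cong[OF refl], rule sum.swap[THEN trans])
       (rule sum.swap)
  also have "\<dots> = (\<Sum>U\<in>D. (\<Prod>p\<in>U. k p) * (\<Sum>S | S \<in> D \<and> U \<subseteq> S. v S)\<^sup>2)"
  proof (intro sum.cong refl)
    fix U assume "U \<in> D"
    have "(\<Sum>S\<in>D. \<Sum>T\<in>D. if U \<subseteq> S \<and> U \<subseteq> T then v S * v T * (\<Prod>p\<in>U. k p) else 0)
      = (\<Prod>p\<in>U. k p) * ((\<Sum>S\<in>D. if U \<subseteq> S then v S else 0) * (\<Sum>T\<in>D. if U \<subseteq> T then v T else 0))"
      by (subst sum_product, unfold sum_distrib_left, intro sum.cong refl) auto
    then show "(\<Sum>S\<in>D. \<Sum>T\<in>D. if U \<subseteq> S \<and> U \<subseteq> T then v S * v T * (\<Prod>p\<in>U. k p) else 0)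
      = (\<Prod>p\<in>U. k p) * (\<Sum>S | S \<in> D \<and> U \<subseteq> S. v S)\<^sup>2"
      using fin by (simp add: sum.inter_filter power2_eq_square)
  qed
  finally show ?thesis .
qed

text \<open>
  The weights are those of Selberg, but only the trivial bound for them is proved; it costs a power of
  the sieve level in the error term, which is affordable since the level may be a small power
  of \<open>N\<close>.
\<close>

lemma selberg_weights:
  fixes w :: "'a \<Rightarrow> real"
  assumes fin: "finite D" and fin': "\<And>S. S \<in> D \<Longrightarrow> finite S"
    and down: "\<And>S T. S \<in> D \<Longrightarrow> T \<subseteq> S \<Longrightarrow> T \<in> D" and empty: "{} \<in> D"
    and w: "\<And>S p. S \<in> D \<Longrightarrow> p \<in> S \<Longrightarrow> 0 < w p \<and> w p < 1"
  defines "V \<equiv> (\<Sum>S\<in>D. \<Prod>p\<in>S. w p / (1 - w p))"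
  obtains l :: "'a set \<Rightarrow> real" where "l {} = 1"
    "\<And>S. S \<in> D \<Longrightarrow> \<bar>l S\<bar> \<le> 1 / (\<Prod>p\<in>S. w p)"
    "(\<Sum>S\<in>D. \<Sum>T\<in>D. l S * l T * (\<Prod>p\<in>S \<union> T. w p)) = 1 / V"
proof -
  define g where "g = (\<lambda>S. \<Prod>p\<in>S. w p / (1 - w p))"
  define W where "W = (\<lambda>S. \<Prod>p\<in>S. w p)"
  have gpos: "g S > 0" if "S \<in> D" for S
    unfolding g_def using w[OF that] by (intro prod_pos) auto
  have Wpos: "W S > 0" if "S \<in> D" for S
    unfolding W_def using w[OF that] by (intro prod_pos) auto
  have V: "V = sum g D" by (simp add: V_def g_def)
  have Vpos: "V > 0"
    unfolding V using fin empty gpos by (intro sum_pos) auto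
  \<comment> \<open>In terms of the superset sums of \<open>v\<close>, the normalization
    \<open>v {} = 1\<close> is a linear constraint, and the diagonal form is smallest when the sum
    at \<open>U\<close> is \<open>(-1) ^ card U * g U / V\<close>. Moebius inversion of these values
    gives \<open>v\<close>.\<close>
  define v where "v = (\<lambda>S. (-1) ^ card S * (\<Sum>X | X \<in> D \<and> S \<subseteq> X. g X) / V)"
  define l where "l = (\<lambda>S. v S / W S)"
  have y: "(\<Sum>S | S \<in> D \<and> U \<subseteq> S. v S) = (-1) ^ card U * g U / V" if U: "U \<in> D" for U
  proof -
    have "(\<Sum>S | S \<in> D \<and> U \<subseteq> S. v S)
        = (\<Sum>S\<in>D. \<Sum>X\<in>D. if U \<subseteq> S \<and> S \<subseteq> X then (-1) ^ card S * g X / V else 0)"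
    proof -
      have "(\<Sum>S | S \<in> D \<and> U \<subseteq> S. v S) = (\<Sum>S\<in>D. if U \<subseteq> S then v S else 0)"
        using fin by (simp add: sum.inter_filter)
      also have "\<dots> = (\<Sum>S\<in>D. \<Sum>X\<in>D. if U \<subseteq> S \<and> S \<subseteq> X then (-1) ^ card S * g X / V else 0)"
      proof (intro sum.cong refl)
        fix S
        have "v S = (\<Sum>X\<in>D. if S \<subseteq> X then (-1) ^ card S * g X / V else 0)"
          using fin by (simp add: v_def sum_distrib_left sum_divide_distrib flip: sum.inter_filter)
        then show "(if U \<subseteq> S then v S else 0) = (\<Sum>X\<in>D. if U \<subseteq> S \<and> S \<subseteq> X then (-1) ^ card S * g X / V else 0)"
          by auto
      qed
      finally show ?thesis .
    qed
    also have "\<dots> = (\<Sum>X\<in>D. \<Sum>S\<in>D. if U \<subseteq> S \<and> S \<subseteq> X then (-1) ^ card S * g X / V else 0)"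
      by (rule sum.swap)
    also have "\<dots> = (\<Sum>X\<in>D. if U = X then (-1) ^ card U * g U / V else 0)"
    proof (intro sum.cong refl)
      fix X assume X: "X \<in> D"
      have eq: "{S \<in> D. U \<subseteq> S \<and> S \<subseteq> X} = {S. U \<subseteq> S \<and> S \<subseteq> X}"
        using down[OF X] by auto
      have "(\<Sum>S\<in>D. if U \<subseteq> S \<and> S \<subseteq> X then (-1) ^ card S * g X / V else 0)
          = (\<Sum>S | U \<subseteq> S \<and> S \<subseteq> X. (-1) ^ card S) * (g X / V)"
        using fin by (simp add: eq sum_distrib_right sum_divide_distrib flip: sum.inter_filter)
      also have "\<dots> = (if U = X then (-1) ^ card U * g U / V else 0)"
      proof (cases "U \<subseteq> X")
        case True
        then show ?thesis using sum_alternating_between[OF fin'[OF X] True] by auto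
      next
        case False
        then have "{S. U \<subseteq> S \<and> S \<subseteq> X} = {}" "U \<noteq> X" by auto
        then show ?thesis by (simp only: sum.empty if_False mult_zero_left)
      qed
      finally show "(\<Sum>S\<in>D. if U \<subseteq> S \<and> S \<subseteq> X then (-1) ^ card S * g X / V else 0)
        = (if U = X then (-1) ^ card U * g U / V else 0)" .
    qed
    also have "\<dots> = (-1) ^ card U * g U / V"
      using fin U by (simp add: sum.delta)
    finally show ?thesis .
  qed
  show thesis
  proof
    show "l {} = 1"
      using Vpos by (simp add: l_def v_def W_def V)
  next
    fix S assume S: "S \<in> D"
    have "(\<Sum>X | X \<in> D \<and> S \<subseteq> X. g X) \<ge> 0"
      using gpos by (intro sum_nonneg) (auto intro: less_imp_le)
    then have "\<bar>v S\<bar> = (\<Sum>X | X \<in> D \<and> S \<subseteq> X. g X) / V"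
      using Vpos by (simp add: v_def abs_mult power_abs)
    also have "\<dots> \<le> 1"
    proof -
      have "(\<Sum>X | X \<in> D \<and> S \<subseteq> X. g X) \<le> V"
        unfolding V using fin gpos by (intro sum_mono2) (auto intro: less_imp_le)
      then show ?thesis using Vpos by simp
    qed
    finally have "\<bar>v S\<bar> \<le> 1" .
    then show "\<bar>l S\<bar> \<le> 1 / (\<Prod>p\<in>S. w p)"
      using Wpos[OF S] by (simp add: l_def abs_divide divide_right_mono flip: W_def)
  next
    \<comment> \<open>Since \<open>1 + k p\<close> is \<open>1 / w p\<close>, products over unions
      turn into products over intersections; moreover the product of \<open>k\<close> over
      \<open>U\<close> is the inverse of \<open>g U\<close>.\<close>
    define k where "k = (\<lambda>p. 1 / w p - 1)"
    have "(\<Sum>S\<in>D. \<Sum>T\<in>D. l S * l T * (\<Prod>p\<in>S \<union> T. w p))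
        = (\<Sum>S\<in>D. \<Sum>T\<in>D. v S * v T * (\<Prod>p\<in>S \<inter> T. 1 + k p))"
    proof (intro sum.cong refl)
      fix S T assume ST: "S \<in> D" "T \<in> D"
      have "W (S \<union> T) * W (S \<inter> T) = W S * W T"
        unfolding W_def using ST fin' by (intro prod.union_inter) auto
      moreover have "(\<Prod>p\<in>S \<inter> T. 1 + k p) = 1 / W (S \<inter> T)"
        unfolding W_def k_def by (simp add: prod_dividef)
      moreover have "W (S \<inter> T) > 0" using Wpos down[OF ST(1)] by blast
      ultimately have "W (S \<union> T) = W S * W T * (\<Prod>p\<in>S \<inter> T. 1 + k p)"
        by (metis nonzero_eq_divide_eq times_divide_eq_right mult.right_neutral less_irrefl)
      then show "l S * l T * (\<Prod>p\<in>S \<union> T. w p) = v S * v T * (\<Prod>p\<in>S \<inter> T. 1 + k p)"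
        using Wpos[OF ST(1)] Wpos[OF ST(2)] by (simp add: l_def flip: W_def)
    qed
    also have "\<dots> = (\<Sum>U\<in>D. (\<Prod>p\<in>U. k p) * (\<Sum>S | S \<in> D \<and> U \<subseteq> S. v S)\<^sup>2)"
      using fin fin' down by (rule selberg_diagonalization)
    also have "\<dots> = (\<Sum>U\<in>D. g U / V\<^sup>2)"
    proof (intro sum.cong refl)
      fix U assume U: "U \<in> D"
      have "(\<Prod>p\<in>U. k p) = (\<Prod>p\<in>U. inverse (w p / (1 - w p)))"
        using w[OF U] by (intro prod.cong) (force simp: k_def field_simps)+
      also have "\<dots> = inverse (g U)"
        unfolding g_def using prod_inversef[of "\<lambda>p. w p / (1 - w p)" U] by (simp only: o_def)
      finally show "(\<Prod>p\<in>U. k p) * (\<Sum>S | S \<in> D \<and> U \<subseteq> S. v S)\<^sup>2 = g U / V\<^sup>2"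
        using gpos[OF U] by (simp add: y[OF U] power_mult_distrib power_divide power2_eq_square
            field_simps)
    qed
    also have "\<dots> = 1 / V"
      using Vpos by (simp add: V power2_eq_square flip: sum_divide_distrib)
    finally show "(\<Sum>S\<in>D. \<Sum>T\<in>D. l S * l T * (\<Prod>p\<in>S \<union> T. w p)) = 1 / V" .
  qed
qed

text \<open>In the application \<open>Z m\<close> is the set of primes that forbid \<open>m\<close>.
  As \<open>l {} = 1\<close>, the squared sum of the weights over \<open>S \<subseteq> Z m\<close>
  is nonnegative, and it is 1 for every counted \<open>m\<close>. Expanding the square gives the
  main term from the weights, plus an error of at most \<open>B * B * R\<close> for each pair
  \<open>S\<close>, \<open>T\<close>.\<close>

theorem selberg_sieve:
  fixes w :: "'a \<Rightarrow> real" and Z :: "'b \<Rightarrow> 'a set"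
  assumes fin: "finite D" and fin': "\<And>S. S \<in> D \<Longrightarrow> finite S"
    and down: "\<And>S T. S \<in> D \<Longrightarrow> T \<subseteq> S \<Longrightarrow> T \<in> D" and empty: "{} \<in> D"
    and w: "\<And>S p. S \<in> D \<Longrightarrow> p \<in> S \<Longrightarrow> 0 < w p \<and> w p < 1"
    and M: "finite M"
    and err: "\<And>S T. S \<in> D \<Longrightarrow> T \<in> D \<Longrightarrow>
      \<bar>real (card {m \<in> M. S \<union> T \<subseteq> Z m}) - X * (\<Prod>p\<in>S \<union> T. w p)\<bar> \<le> R"
    and B: "\<And>S. S \<in> D \<Longrightarrow> 1 / (\<Prod>p\<in>S. w p) \<le> B"
  shows "real (card {m \<in> M. \<forall>S\<in>D. S \<subseteq> Z m \<longrightarrow> S = {}})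
      \<le> X / (\<Sum>S\<in>D. \<Prod>p\<in>S. w p / (1 - w p)) + (real (card D) * B)\<^sup>2 * R"
proof -
  define V where "V = (\<Sum>S\<in>D. \<Prod>p\<in>S. w p / (1 - w p))"
  obtain l :: "'a set \<Rightarrow> real" where l: "l {} = 1"
    "\<And>S. S \<in> D \<Longrightarrow> \<bar>l S\<bar> \<le> 1 / (\<Prod>p\<in>S. w p)"
    "(\<Sum>S\<in>D. \<Sum>T\<in>D. l S * l T * (\<Prod>p\<in>S \<union> T. w p)) = 1 / V"
    by (rule selberg_weights[of D w, folded V_def]) (use fin fin' down empty w in blast)+
  have lB: "\<bar>l S\<bar> \<le> B" if "S \<in> D" for S
    using l(2)[OF that] B[OF that] by linarith
  define G where "G = {m \<in> M. \<forall>S\<in>D. S \<subseteq> Z m \<longrightarrow> S = {}}"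
  have "real (card G) = (\<Sum>m\<in>G. (\<Sum>S\<in>D. if S \<subseteq> Z m then l S else 0)\<^sup>2)"
  proof -
    have "(\<Sum>S\<in>D. if S \<subseteq> Z m then l S else 0) = 1" if "m \<in> G" for m
    proof -
      have "(\<Sum>S\<in>D. if S \<subseteq> Z m then l S else 0) = (\<Sum>S\<in>D. if S = {} then l S else 0)"
        using that by (intro sum.cong refl) (auto simp: G_def)
      also have "\<dots> = 1" using fin empty l(1) by simp
      finally show ?thesis .
    qed
    then show ?thesis by simp
  qed
  also have "\<dots> \<le> (\<Sum>m\<in>M. (\<Sum>S\<in>D. if S \<subseteq> Z m then l S else 0)\<^sup>2)"
    using M by (intro sum_mono2) (auto simp: G_def)
  also have "\<dots> = (\<Sum>m\<in>M. \<Sum>S\<in>D. \<Sum>T\<in>D. if S \<union> T \<subseteq> Z m then l S * l T else 0)"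
    unfolding power2_eq_square sum_product by (intro sum.cong refl) auto
  also have "\<dots> = (\<Sum>S\<in>D. \<Sum>T\<in>D. \<Sum>m\<in>M. if S \<union> T \<subseteq> Z m then l S * l T else 0)"
    by (subst sum.swap, subst (2) sum.swap) (rule refl)
  also have "\<dots> = (\<Sum>S\<in>D. \<Sum>T\<in>D. l S * l T * real (card {m \<in> M. S \<union> T \<subseteq> Z m}))"
    using M by (simp add: mult.commute flip: sum.inter_filter)
  also have "\<dots> \<le> (\<Sum>S\<in>D. \<Sum>T\<in>D. X * (l S * l T * (\<Prod>p\<in>S \<union> T. w p)) + B * B * R)"
  proof (intro sum_mono)
    fix S T assume ST: "S \<in> D" "T \<in> D"
    let ?c = "real (card {m \<in> M. S \<union> T \<subseteq> Z m})" and ?w = "\<Prod>p\<in>S \<union> T. w p"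
    have "l S * l T * ?c - X * (l S * l T * ?w) = (l S * l T) * (?c - X * ?w)"
      by (simp add: algebra_simps)
    also have "\<dots> \<le> \<bar>(l S * l T) * (?c - X * ?w)\<bar>" by simp
    also have "\<dots> = \<bar>l S\<bar> * \<bar>l T\<bar> * \<bar>?c - X * ?w\<bar>" by (simp add: abs_mult)
    also have "\<dots> \<le> B * B * R"
      using lB[OF ST(1)] lB[OF ST(2)] err[OF ST] by (intro mult_mono) auto
    finally show "l S * l T * ?c \<le> X * (l S * l T * ?w) + B * B * R" by simp
  qed
  also have "\<dots> = X / V + (real (card D) * B)\<^sup>2 * R"
    by (simp add: sum.distrib l(3) power2_eq_square flip: sum_distrib_left)
  finally show ?thesis unfolding G_def V_def .
qed

section \<open>Residue conditions modulo several primes\<close>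

text \<open>By induction on \<open>S\<close>: the Chinese remainder theorem for the coprime moduli
  \<open>q\<close> and \<open>\<Prod>S\<close> makes the condition at a new prime independent of the
  earlier ones.\<close>

lemma card_residue_conditions:
  fixes S :: "nat set"
  assumes "finite S" "\<And>p. p \<in> S \<Longrightarrow> prime p" "\<And>p. p \<in> S \<Longrightarrow> Om p \<subseteq> {..<p}"
  shows "card {m. m < \<Prod>S \<and> (\<forall>p\<in>S. m mod p \<in> Om p)} = (\<Prod>p\<in>S. card (Om p))"
  using assms
proof (induction S rule: finite_induct)
  case empty
  have "{m :: nat. m < Suc 0} = {0}" by auto
  then show ?case by simp
next
  case (insert q S)
  let ?P = "\<Prod>S"
  have cop: "coprime q ?P"
    using insert by (intro prod_coprime_right) (auto intro!: primes_coprime)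
  have pos: "?P > 0" "q > 0"
    using insert.prems(1) prime_gt_0_nat by (auto intro!: prod_pos)
  let ?A = "{m. m < \<Prod>(insert q S) \<and> (\<forall>p\<in>insert q S. m mod p \<in> Om p)}"
  let ?B = "{m. m < ?P \<and> (\<forall>p\<in>S. m mod p \<in> Om p)}"
  have mm: "m mod ?P mod p = m mod p" if "p \<in> S" for m p
    using insert.hyps(1) that by (intro mod_mod_cancel) (auto intro: dvd_prodI)
  have "bij_betw (\<lambda>m. (m mod q, m mod ?P)) ?A (Om q \<times> ?B)"
  proof (rule bij_betw_imageI)
    show "inj_on (\<lambda>m. (m mod q, m mod ?P)) ?A"
    proof (rule inj_onI)
      fix x y assume xy: "x \<in> ?A" "y \<in> ?A" "(x mod q, x mod ?P) = (y mod q, y mod ?P)"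
      then have "[x = y] (mod q)" "[x = y] (mod ?P)" by (auto simp: unique_euclidean_semiring_class.cong_def)
      then have "[x = y] (mod q * ?P)" using cop by (simp add: coprime_cong_mult_nat)
      then show "x = y" using xy insert.hyps by (auto simp: unique_euclidean_semiring_class.cong_def)
    qed
    show "(\<lambda>m. (m mod q, m mod ?P)) ` ?A = Om q \<times> ?B"
    proof (intro equalityI subsetI)
      fix z assume "z \<in> (\<lambda>m. (m mod q, m mod ?P)) ` ?A"
      then show "z \<in> Om q \<times> ?B" using pos mm by auto
    next
      fix z assume z: "z \<in> Om q \<times> ?B"
      obtain a b where ab: "z = (a, b)" by force
      obtain x where x: "x < q * ?P" "[x = a] (mod q)" "[x = b] (mod ?P)"
        using binary_chinese_remainder_unique_nat[OF cop, of a b] pos by auto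
      have "a < q" "b < ?P" using z ab insert.prems(2)[of q] by auto
      then have ax: "x mod q = a" "x mod ?P = b" using x by (auto simp: unique_euclidean_semiring_class.cong_def)
      then have "x \<in> ?A" using x(1) z ab insert.hyps mm by force
      then show "z \<in> (\<lambda>m. (m mod q, m mod ?P)) ` ?A" using ax ab by blast
    qed
  qed
  then have "card ?A = card (Om q) * card ?B"
    using bij_betw_same_card[of _ ?A "Om q \<times> ?B"] by (simp only: card_cartesian_product)
  then show ?case using insert by simp
qed

lemma card_periodic:
  fixes q k :: nat
  assumes "\<And>m. P (m + q) = P m"
  shows "card {m. m < q * k \<and> P m} = k * card {m. m < q \<and> P m}"
proof (induction k)
  case (Suc k)
  have per: "P (m + q * k) = P m" for m
  proof (induction k)
    case (Suc k)
    have "m + q * Suc k = (m + q * k) + q" by simp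
    then show ?case using assms Suc by metis
  qed auto
  have eq: "{m. m < q * Suc k \<and> P m} = {m. m < q * k \<and> P m} \<union> (\<lambda>m. m + q * k) ` {m. m < q \<and> P m}"
    (is "?A = ?B \<union> ?C")
  proof (intro equalityI subsetI)
    fix m assume m: "m \<in> ?A"
    show "m \<in> ?B \<union> ?C"
    proof (cases "m < q * k")
      case False
      then have "m = (m - q * k) + q * k" "m - q * k < q" using m by auto
      moreover then have "P (m - q * k)" using per[of "m - q * k"] m by auto
      ultimately show ?thesis by blast
    qed (use m in auto)
  qed (use per in auto)
  have "card ?A = card ?B + card ?C"
    unfolding eq by (intro card_Un_disjoint) auto
  also have "card ?C = card {m. m < q \<and> P m}"
    by (intro card_image) (auto intro: inj_onI)
  finally show ?case using Suc by simp
qed auto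

text \<open>The condition has period \<open>q = \<Prod>S\<close>, and \<open>c\<close> residues
  satisfy it. If \<open>k\<close> complete periods fit below \<open>N\<close>, the count and its
  expected value both lie between \<open>k * c\<close> and \<open>(k + 1) * c\<close>, so they
  differ by at most \<open>c \<le> q\<close>.\<close>

lemma card_residue_conditions_interval:
  fixes S :: "nat set" and N :: nat
  assumes "finite S" "\<And>p. p \<in> S \<Longrightarrow> prime p" "\<And>p. p \<in> S \<Longrightarrow> Om p \<subseteq> {..<p}"
  shows "\<bar>real (card {m \<in> {..<N}. \<forall>p\<in>S. m mod p \<in> Om p}) - real N * (\<Prod>p\<in>S. real (card (Om p)) / real p)\<bar>
    \<le> real (\<Prod>S)"
proof -
  define q where "q = \<Prod>S"
  define P where "P = (\<lambda>m. \<forall>p\<in>S. m mod p \<in> Om p)"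
  define c where "c = card {m. m < q \<and> P m}"
  have qpos: "q > 0"
    unfolding q_def using assms(2) prime_gt_0_nat by (auto intro!: prod_pos)
  have c: "real c = (\<Prod>p\<in>S. real (card (Om p)))"
    using card_residue_conditions[OF assms] by (simp add: c_def P_def q_def)
  have cq: "c \<le> q"
    using card_mono[of "{..<q}" "{m. m < q \<and> P m}"] by (auto simp: c_def)
  have "P (m + q) = P m" for m
  proof -
    have "(m + q) mod p = m mod p" if "p \<in> S" for p
      using that assms(1) by (metis dvd_prodI q_def mod_add_right_eq mod_0_imp_dvd dvd_imp_mod_0 add.right_neutral)
    then show ?thesis by (simp add: P_def)
  qed
  note per = card_periodic[of P, OF this]
  define k where "k = N div q"
  define C where "C = card {m \<in> {..<N}. P m}"
  have lt: "q * k \<le> N" "N < q * Suc k"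
    using qpos by (simp_all add: k_def) (metis dividend_less_times_div mult_Suc_right add.commute)
  have "k * c \<le> C"
    unfolding C_def c_def per[symmetric] using lt by (intro card_mono) auto
  moreover have "C \<le> Suc k * c"
    unfolding C_def c_def per[symmetric] using lt by (intro card_mono) auto
  ultimately have C: "real k * c \<le> C" "real C \<le> (real k + 1) * c"
    using of_nat_mono[of "k * c" C] of_nat_mono[of C "Suc k * c"] by (simp_all add: algebra_simps)
  define x where "x = real N * (\<Prod>p\<in>S. real (card (Om p)) / real p)"
  have x: "x * q = N * real c"
  proof -
    have "x * q = real N * real c / real q * q"
      by (simp add: x_def c prod_dividef q_def)
    then show ?thesis using qpos by simp
  qed
  have "real q * k \<le> N" "real N \<le> q * (real k + 1)"
    using of_nat_mono[OF lt(1)] of_nat_mono[OF less_imp_le[OF lt(2)]] by (simp_all add: algebra_simps)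
  then have "(real q * k) * c \<le> real N * c" "real N * c \<le> (q * (real k + 1)) * c"
    by (simp_all add: mult_right_mono)
  then have "q * (real k * c) \<le> q * x" "q * x \<le> q * ((real k + 1) * c)"
    using x by (simp_all add: algebra_simps)
  then have "real k * c \<le> x" "x \<le> (real k + 1) * c"
    using qpos by simp_all
  then have "\<bar>real C - x\<bar> \<le> c" using C by (simp add: algebra_simps abs_le_iff)
  moreover have "real c \<le> real (\<Prod>S)" using cq unfolding q_def by (rule of_nat_mono)
  ultimately show ?thesis unfolding C_def x_def P_def by linarith
qed

section \<open>The main term of the sieve\<close>

text \<open>By unique factorization, such integers are determined by their exponents at the primes
  of \<open>U\<close>, all of them positive. The sum over exponent vectors splits into geometric
  series, each bounded by \<open>1 / (real p - 1)\<close>.\<close>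

lemma sum_inverse_fixed_prime_factors_le:
  fixes U :: "nat set"
  assumes U: "finite U" "\<And>p. p \<in> U \<Longrightarrow> prime p"
  shows "(\<Sum>k | k \<in> {1..n} \<and> prime_factors k = U. 1 / real k) \<le> (\<Prod>p\<in>U. 1 / (real p - 1))"
proof -
  let ?K = "{k. k \<in> {1..n} \<and> prime_factors k = U}"
  define f where "f = (\<lambda>k::nat. \<lambda>p\<in>U. multiplicity p k)"
  have K: "real k = (\<Prod>p\<in>U. real p ^ f k p)" if "k \<in> ?K" for k
  proof -
    have "k = (\<Prod>p\<in>prime_factors k. p ^ multiplicity p k)"
      using that by (intro prime_factorization_nat) auto
    also have "\<dots> = (\<Prod>p\<in>U. p ^ f k p)"
      using that by (auto simp: f_def intro!: prod.cong)
    finally have "real k = real (\<Prod>p\<in>U. p ^ f k p)" by (rule arg_cong)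
    then show ?thesis by simp
  qed
  have inj: "inj_on f ?K"
  proof (rule inj_onI)
    fix x y assume "x \<in> ?K" "y \<in> ?K" "f x = f y"
    then show "x = y" using K[of x] K[of y] by simp
  qed
  \<comment> \<open>The crude bound
    \<open>multiplicity p k < p ^ multiplicity p k \<le> k \<le> n\<close> confines the exponents to
    a finite box.\<close>
  have im: "f ` ?K \<subseteq> (U \<rightarrow>\<^sub>E {1..n})"
  proof (clarsimp simp: f_def PiE_iff)
    fix k p assume k: "Suc 0 \<le> k" "k \<le> n" "p \<in> prime_factors k"
    have "p ^ multiplicity p k \<le> k"
      using k by (intro dvd_imp_le multiplicity_dvd) auto
    moreover have "multiplicity p k < p ^ multiplicity p k"
      using k by (intro power_gt_expt) (auto simp: in_prime_factors_iff prime_gt_Suc_0_nat)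
    moreover have "multiplicity p k \<ge> 1"
      using k(3) by (simp add: prime_factors_multiplicity Suc_le_eq)
    ultimately show "Suc 0 \<le> multiplicity p k \<and> multiplicity p k \<le> n"
      using k by simp
  qed
  have "(\<Sum>k\<in>?K. 1 / real k) = (\<Sum>k\<in>?K. \<Prod>p\<in>U. (1 / real p) ^ f k p)"
    by (intro sum.cong refl) (simp add: K power_divide prod_dividef)
  also have "\<dots> = (\<Sum>h\<in>f ` ?K. \<Prod>p\<in>U. (1 / real p) ^ h p)"
    by (subst sum.reindex[OF inj]) simp
  also have "\<dots> \<le> (\<Sum>h\<in>U \<rightarrow>\<^sub>E {1..n}. \<Prod>p\<in>U. (1 / real p) ^ h p)"
    using im U by (intro sum_mono2 finite_PiE) (auto intro!: prod_nonneg)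
  also have "\<dots> = (\<Prod>p\<in>U. \<Sum>j\<in>{1..n}. (1 / real p) ^ j)"
    using U by (subst prod_sum_PiE) auto
  also have "\<dots> \<le> (\<Prod>p\<in>U. 1 / (real p - 1))"
  proof (intro prod_mono conjI sum_nonneg)
    fix p assume "p \<in> U"
    then have p: "real p > 1" using U(2) prime_gt_1_nat by auto
    have "(\<Sum>j\<in>{1..n}. (1 / real p) ^ j) = (1 - (1 / real p) ^ n) / (real p - 1)"
    proof (induction n)
      case (Suc n)
      have "(\<Sum>j\<in>{1..Suc n}. (1 / real p) ^ j) = (1 - (1 / real p) ^ n) / (real p - 1) + (1 / real p) ^ n / real p"
        using Suc by simp
      also have "\<dots> = (1 - (1 / real p) ^ Suc n) / (real p - 1)"
        using p by (simp add: divide_simps) (simp add: algebra_simps)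
      finally show ?case .
    qed simp
    also have "\<dots> \<le> 1 / (real p - 1)"
      using p by (intro divide_right_mono) auto
    finally show "(\<Sum>j\<in>{1..n}. (1 / real p) ^ j) \<le> 1 / (real p - 1)" .
  qed auto
  finally show ?thesis .
qed

text \<open>These are the sets of prime factors of the squarefree numbers up to \<open>n\<close>.
  The bound on each element forces finiteness, which the bound on the product cannot do, an infinite
  product being 1 by convention.\<close>

definition prime_sets :: "nat \<Rightarrow> nat set set" where
  "prime_sets n = {U. U \<subseteq> {p. prime p \<and> p \<le> n} \<and> \<Prod>U \<le> n}"

lemma finite_prime_sets [simp]: "finite (prime_sets n)"
  by (rule finite_subset[of _ "Pow {..n}"]) (auto simp: prime_sets_def)

lemma prime_setsD:
  assumes "U \<in> prime_sets n"
  shows "finite U" "\<And>p. p \<in> U \<Longrightarrow> prime p" "\<Prod>U \<le> n"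
  using assms finite_subset[of U "{..n}"] by (auto simp: prime_sets_def)

lemma prod_primes_pos:
  fixes U :: "nat set"
  assumes "\<And>p. p \<in> U \<Longrightarrow> prime p"
  shows "\<Prod>U > 0"
  using assms prime_gt_0_nat by (intro prod_pos) auto

lemma prime_sets_subset:
  assumes "U \<in> prime_sets n" "T \<subseteq> U"
  shows "T \<in> prime_sets n"
proof -
  have "\<Prod>T dvd \<Prod>U" using assms prime_setsD by (intro prod_dvd_prod_subset) auto
  then have "\<Prod>T \<le> \<Prod>U"
    using assms prime_setsD by (intro dvd_imp_le prod_primes_pos) auto
  then show ?thesis using assms by (auto simp: prime_sets_def)
qed

lemma prime_factors_prod_primes:
  fixes U :: "nat set"
  assumes "finite U" "\<And>p. p \<in> U \<Longrightarrow> prime p"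
  shows "prime_factors (\<Prod>U) = U"
proof -
  have "0 \<notin> U" using assms(2) not_prime_0 by blast
  then have "prime_factors (\<Prod>U) = (\<Union>p\<in>U. prime_factors p)"
    using prime_factors_prod[of U "\<lambda>p. p"] assms(1) by simp
  also have "\<dots> = U" using assms by (simp add: prime_prime_factors)
  finally show ?thesis .
qed

lemma card_prime_sets: "card (prime_sets n) \<le> n"
proof -
  have "inj_on (\<lambda>U. \<Prod>U) (prime_sets n)"
    by (rule inj_on_inverseI[of _ prime_factors], rule prime_factors_prod_primes)
       (rule prime_setsD; assumption)+
  moreover have "(\<lambda>U. \<Prod>U) ` prime_sets n \<subseteq> {1..n}"
  proof clarify
    fix U assume U: "U \<in> prime_sets n"
    have "\<Prod>U > 0" by (rule prod_primes_pos) (rule prime_setsD(2)[OF U])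
    with prime_setsD(3)[OF U] show "\<Prod>U \<in> {1..n}" by simp
  qed
  ultimately have "card (prime_sets n) \<le> card {1..n}" by (rule card_inj_on_le) simp
  then show ?thesis by simp
qed

text \<open>The integers up to \<open>n\<close> are grouped by their sets of prime factors, which
  belong to \<open>prime_sets n\<close> because the radical of \<open>k\<close> divides
  \<open>k\<close>. The right side is the main sum of the sieve for densities
  \<open>1 / p\<close>.\<close>

lemma harm_le_sum_prime_sets:
  "harm n \<le> (\<Sum>U\<in>prime_sets n. \<Prod>p\<in>U. 1 / (real p - 1))"
proof -
  have im: "prime_factors ` {1..n} \<subseteq> prime_sets n"
  proof safe
    fix k assume k: "k \<in> {1..n}"
    have "\<Prod>(prime_factors k) dvd (\<Prod>p\<in>prime_factors k. p ^ multiplicity p k)"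
      by (intro prod_dvd_prod) (auto simp: prime_factors_multiplicity)
    also have "\<dots> = k"
      using k by (intro prime_factorization_nat[symmetric]) auto
    finally have "\<Prod>(prime_factors k) \<le> k" using k by (intro dvd_imp_le) auto
    moreover have "p \<le> k" if "p \<in> prime_factors k" for p
      using that k by (intro dvd_imp_le) auto
    ultimately show "prime_factors k \<in> prime_sets n"
      using k by (fastforce simp: prime_sets_def)
  qed
  have "harm n = (\<Sum>k\<in>{1..n}. 1 / real k)"
    by (simp add: harm_def inverse_eq_divide)
  also have "\<dots> = (\<Sum>U\<in>prime_sets n. \<Sum>k | k \<in> {1..n} \<and> prime_factors k = U. 1 / real k)"
    using im by (intro sum.group[symmetric]) auto
  also have "\<dots> \<le> (\<Sum>U\<in>prime_sets n. \<Prod>p\<in>U. 1 / (real p - 1))"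
    by (intro sum_mono sum_inverse_fixed_prime_factors_le) (use prime_setsD in auto)
  finally show ?thesis .
qed

text \<open>Sets of primes are split into a part in \<open>L\<close> and a part outside. After
  shrinking the level by the factor \<open>\<Prod>L\<close>, every outside part may be combined with
  every subset of \<open>L\<close>, so that the sums factor. The density \<open>2 / p\<close> at
  \<open>p \<in> L\<close> is worth at least two factors \<open>1 + 1 / (real p - 1)\<close>: one is
  consumed by the harmonic sum, the other is the gain.\<close>

lemma selberg_sum_lower_bound:
  fixes L :: "nat set" and n :: nat
  assumes L: "finite L" "\<And>p. p \<in> L \<Longrightarrow> prime p \<and> 3 \<le> p"
  defines "w \<equiv> \<lambda>p. (if p \<in> L then 2 else 1) / real p"
  shows "harm (n div \<Prod>L) * (\<Prod>p\<in>L. 1 + 1 / (real p - 1))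
    \<le> (\<Sum>U\<in>prime_sets n. \<Prod>p\<in>U. w p / (1 - w p))"
proof -
  define C where "C = \<Prod>L"
  define g where "g = (\<lambda>p. w p / (1 - w p))"
  define g1 where "g1 = (\<lambda>p::nat. 1 / (real p - 1))"
  \<comment> \<open>The parts outside \<open>L\<close>; the factor \<open>C\<close> leaves room
    below \<open>n\<close> for adjoining any subset of \<open>L\<close>.\<close>
  define E where "E = {U. U \<subseteq> {p. prime p \<and> p \<le> n} - L \<and> C * \<Prod>U \<le> n}"
  have Cpos: "C > 0" unfolding C_def using L by (intro prod_primes_pos) auto
  have finE: "finite E"
    by (rule finite_subset[of _ "Pow {..n}"]) (auto simp: E_def)
  have finE': "finite U" if "U \<in> E" for U
    using that finite_subset[of U "{..n}"] by (auto simp: E_def)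
  have gL: "g p = 2 / (real p - 2)" if "p \<in> L" for p
    using L(2)[OF that] that by (auto simp: g_def w_def field_simps)
  have gL': "g p = g1 p" if "prime p" "p \<notin> L" for p
    using that prime_gt_1_nat[of p] by (auto simp: g_def w_def g1_def field_simps)
  have g1pos: "g1 p > 0" if "prime p" for p
    using that prime_gt_1_nat[of p] by (auto simp: g1_def)
  have gpos: "g p > 0" if "prime p" for p
    using that L(2)[of p] gL gL' g1pos by (cases "p \<in> L") auto
  have ge1: "C * \<Prod>U \<le> n \<Longrightarrow> A \<subseteq> L \<Longrightarrow> \<Prod>A * \<Prod>U \<le> n" for A U :: "nat set"
  proof -
    assume a: "C * \<Prod>U \<le> n" "A \<subseteq> L"
    have "\<Prod>A dvd C" unfolding C_def using a L by (intro prod_dvd_prod_subset) auto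
    then have "\<Prod>A \<le> C" using Cpos by (intro dvd_imp_le) auto
    then have "\<Prod>A * \<Prod>U \<le> C * \<Prod>U" by simp
    with a show ?thesis by linarith
  qed
  have nz: "\<Prod>U > 0" if "U \<in> E" for U
    using that by (intro prod_primes_pos) (auto simp: E_def)
  have lower: "(\<Sum>A\<in>Pow L. prod g A) * (\<Sum>U\<in>E. prod g U) \<le> (\<Sum>U\<in>prime_sets n. prod g U)"
  proof -
    have "(\<Sum>A\<in>Pow L. prod g A) * (\<Sum>U\<in>E. prod g U) = (\<Sum>(A, U)\<in>Pow L \<times> E. prod g (A \<union> U))"
      unfolding sum_product sum.cartesian_product
    proof (intro sum.cong refl, clarify)
      fix A U assume AU: "A \<subseteq> L" "U \<in> E"
      have "finite A" using AU(1) L(1) by (rule finite_subset)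
      moreover have "A \<inter> U = {}" using AU by (auto simp: E_def)
      ultimately show "prod g A * prod g U = prod g (A \<union> U)"
        using finE'[OF AU(2)] by (simp add: prod.union_disjoint)
    qed
    also have "\<dots> = (\<Sum>X\<in>(\<lambda>(A, U). A \<union> U) ` (Pow L \<times> E). prod g X)"
    proof (subst sum.reindex)
      show "inj_on (\<lambda>(A, U). A \<union> U) (Pow L \<times> E)"
        by (rule inj_on_inverseI[of _ "\<lambda>X. (X \<inter> L, X - L)"]) (auto simp: E_def)
    qed (simp add: case_prod_unfold o_def)
    also have "\<dots> \<le> (\<Sum>U\<in>prime_sets n. prod g U)"
    proof (intro sum_mono2)
      show "(\<lambda>(A, U). A \<union> U) ` (Pow L \<times> E) \<subseteq> prime_sets n"
      proof clarify
        fix A U assume AU: "A \<subseteq> L" "U \<in> E"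
        have fA: "finite A" using AU(1) L(1) by (rule finite_subset)
        have "A \<inter> U = {}" using AU by (auto simp: E_def)
        then have "\<Prod>(A \<union> U) = \<Prod>A * \<Prod>U"
          using finE'[OF AU(2)] fA by (intro prod.union_disjoint)
        also have le: "\<dots> \<le> n" using AU ge1 by (auto simp: E_def)
        finally have 1: "\<Prod>(A \<union> U) \<le> n" .
        have "p \<le> n" if "p \<in> A" for p
        proof -
          have "p \<le> \<Prod>A"
            using that fA AU L(2) by (intro dvd_imp_le prod_primes_pos dvd_prodI) auto
          also have "\<dots> \<le> \<Prod>A * \<Prod>U" using nz[OF AU(2)] by simp
          finally show ?thesis using le by simp
        qed
        then show "A \<union> U \<in> prime_sets n"
          using 1 AU L(2) by (auto simp: prime_sets_def E_def)
      qed
    next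
      fix X assume "X \<in> prime_sets n - (\<lambda>(A, U). A \<union> U) ` (Pow L \<times> E)"
      then have "X \<in> prime_sets n" by blast
      then show "0 \<le> prod g X"
        by (intro prod_nonneg ballI less_imp_le gpos) (rule prime_setsD(2))
    qed simp
    finally show ?thesis .
  qed
  \<comment> \<open>In the other direction, every member of \<open>prime_sets (n div C)\<close>
    splits into a subset of \<open>L\<close> and a member of \<open>E\<close>. Here
    \<open>g1\<close> belongs to the densities \<open>1 / p\<close> and agrees with \<open>g\<close>
    at the primes outside \<open>L\<close>.\<close>
  have "harm (n div C) \<le> (\<Sum>U\<in>prime_sets (n div C). prod g1 U)"
    unfolding g1_def by (rule harm_le_sum_prime_sets)
  also have "\<dots> = (\<Sum>U\<in>prime_sets (n div C). prod g1 (U \<inter> L) * prod g1 (U - L))"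
  proof (intro sum.cong refl)
    fix U assume "U \<in> prime_sets (n div C)"
    then have "finite U" by (rule prime_setsD)
    then show "prod g1 U = prod g1 (U \<inter> L) * prod g1 (U - L)"
      by (rule prod.Int_Diff)
  qed
  also have "\<dots> = (\<Sum>(A, U)\<in>(\<lambda>U. (U \<inter> L, U - L)) ` prime_sets (n div C). prod g1 A * prod g1 U)"
  proof (subst sum.reindex)
    show "inj_on (\<lambda>U. (U \<inter> L, U - L)) (prime_sets (n div C))"
      by (rule inj_on_inverseI[of _ "\<lambda>(A, U). A \<union> U"]) auto
  qed simp
  also have "\<dots> \<le> (\<Sum>(A, U)\<in>Pow L \<times> E. prod g1 A * prod g1 U)"
  proof (intro sum_mono2)
    show "(\<lambda>U. (U \<inter> L, U - L)) ` prime_sets (n div C) \<subseteq> Pow L \<times> E"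
    proof clarify
      fix U assume U: "U \<in> prime_sets (n div C)"
      have "U - L \<in> prime_sets (n div C)" using U by (rule prime_sets_subset) auto
      then have "\<Prod>(U - L) \<le> n div C" by (rule prime_setsD)
      then have "C * \<Prod>(U - L) \<le> n"
        using Cpos by (simp add: less_eq_div_iff_mult_less_eq mult.commute)
      moreover have "p \<le> n" if "p \<in> U" for p
      proof -
        have "p \<le> n div C" using that U by (auto simp: prime_sets_def)
        then show ?thesis using div_le_dividend[of n C] by linarith
      qed
      ultimately show "U \<inter> L \<in> Pow L \<and> U - L \<in> E"
        using prime_setsD(2)[OF U] by (auto simp: E_def)
    qed
  next
    fix z assume "z \<in> Pow L \<times> E - (\<lambda>U. (U \<inter> L, U - L)) ` prime_sets (n div C)"
    then have z: "z \<in> Pow L \<times> E" by blast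
    have "prod g1 (fst z) \<ge> 0" "prod g1 (snd z) \<ge> 0"
      using z L(2) by (auto simp: E_def intro!: prod_nonneg less_imp_le[OF g1pos])
    then show "0 \<le> (case z of (A, U) \<Rightarrow> prod g1 A * prod g1 U)"
      by (simp add: case_prod_unfold)
  qed (use finE L(1) in simp)
  also have "\<dots> = (\<Sum>A\<in>Pow L. prod g1 A) * (\<Sum>U\<in>E. prod g1 U)"
    unfolding sum_product sum.cartesian_product ..
  also have "(\<Sum>U\<in>E. prod g1 U) = (\<Sum>U\<in>E. prod g U)"
    by (intro sum.cong prod.cong refl gL'[symmetric]) (auto simp: E_def)
  finally have harm: "harm (n div C) \<le> (\<Sum>A\<in>Pow L. prod g1 A) * (\<Sum>U\<in>E. prod g U)" .
  have g1': "1 + g1 p \<ge> 0" if "p \<in> L" for p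
    using g1pos[of p] L(2)[OF that] by simp
  have "harm (n div C) * (\<Prod>p\<in>L. 1 + g1 p)
      \<le> ((\<Sum>A\<in>Pow L. prod g1 A) * (\<Sum>U\<in>E. prod g U)) * (\<Prod>p\<in>L. 1 + g1 p)"
    by (rule mult_right_mono[OF harm prod_nonneg]) (use g1' in blast)
  also have "\<dots> = (\<Prod>p\<in>L. (1 + g1 p) * (1 + g1 p)) * (\<Sum>U\<in>E. prod g U)"
    unfolding prod_one_plus[OF L(1), symmetric] prod.distrib by (simp only: mult_ac)
  also have "\<dots> \<le> (\<Prod>p\<in>L. 1 + g p) * (\<Sum>U\<in>E. prod g U)"
  proof (rule mult_right_mono)
    \<comment> \<open>Factor by factor this is the square of \<open>p / (p - 1)\<close> against
      \<open>p / (p - 2)\<close>, which amounts to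
      \<open>p * (p - 2) \<le> (p - 1) ^ 2\<close>.\<close>
    show "(\<Prod>p\<in>L. (1 + g1 p) * (1 + g1 p)) \<le> (\<Prod>p\<in>L. 1 + g p)"
    proof (intro prod_mono conjI)
      fix p assume p: "p \<in> L"
      then have p3: "real p \<ge> 3" using L(2)[OF p] by simp
      show "0 \<le> (1 + g1 p) * (1 + g1 p)" by simp
      show "(1 + g1 p) * (1 + g1 p) \<le> 1 + g p"
      proof -
        have "(real p - 2) * (real p * real p) \<le> (real p - 1) * (real p - 1) * real p"
          by (simp add: algebra_simps)
        then have "real p * real p / ((real p - 1) * (real p - 1)) \<le> real p / (real p - 2)"
          using p3 by (simp add: divide_simps mult.commute)
        moreover have "1 + g1 p = real p / (real p - 1)" "1 + g p = real p / (real p - 2)"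
          unfolding gL[OF p] g1_def using p3 by (simp_all add: field_simps)
        ultimately show ?thesis by simp
      qed
    qed
    show "(\<Sum>U\<in>E. prod g U) \<ge> 0"
      by (intro sum_nonneg prod_nonneg ballI less_imp_le[OF gpos]) (auto simp: E_def)
  qed
  also have "\<dots> = (\<Sum>A\<in>Pow L. prod g A) * (\<Sum>U\<in>E. prod g U)"
    unfolding prod_one_plus[OF L(1)] ..
  also note lower
  finally show ?thesis by (simp only: C_def g_def g1_def)
qed

section \<open>Chebyshev's lower bound\<close>

definition prime_count :: "nat \<Rightarrow> nat" where
  "prime_count N = card {p. prime p \<and> p \<le> N}"

lemma finite_primes_le [simp]: "finite {p :: nat. prime p \<and> p \<le> N}"
  by (rule finite_subset[of _ "{..N}"]) auto

text \<open>Only prime powers contribute. At most \<open>ln N / ln p\<close> powers of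
  \<open>p\<close> are up to \<open>N\<close>, each with weight \<open>ln p\<close>, so every prime
  accounts for at most \<open>ln N\<close>.\<close>

lemma sum_mangoldt_le: "(\<Sum>d\<in>{1..N}. mangoldt d) \<le> real (prime_count N) * ln (real N)"
proof -
  let ?Q = "{d \<in> {1..N}. primepow d}" and ?P = "{p. prime p \<and> p \<le> N}"
  have "(\<Sum>d\<in>{1..N}. mangoldt d) = (\<Sum>d\<in>?Q. ln (real (aprimedivisor d)))"
    unfolding sum.inter_filter[OF finite_atLeastAtMost] by (intro sum.cong) (auto simp: mangoldt_def)
  also have "\<dots> = (\<Sum>p\<in>?P. \<Sum>d | d \<in> ?Q \<and> aprimedivisor d = p. ln (real (aprimedivisor d)))"
  proof (rule sum.group[symmetric])
    show "aprimedivisor ` ?Q \<subseteq> ?P"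
    proof clarify
      fix d :: nat assume d: "d \<in> {1..N}" "primepow d"
      have "d > 1" using primepow_gt_Suc_0[OF d(2)] by simp
      then have "prime (aprimedivisor d)" "aprimedivisor d dvd d"
        by (simp_all add: prime_aprimedivisor' aprimedivisor_dvd')
      moreover have "aprimedivisor d \<le> d" using \<open>d > 1\<close> calculation(2) by (intro dvd_imp_le) auto
      ultimately show "prime (aprimedivisor d) \<and> aprimedivisor d \<le> N" using d(1) by simp
    qed
  qed auto
  also have "\<dots> \<le> (\<Sum>p\<in>?P. ln (real N))"
  proof (rule sum_mono)
    fix p assume p: "p \<in> ?P"
    define K where "K = nat \<lfloor>ln (real N) / ln (real p)\<rfloor>"
    have p1: "p > 1" "p \<le> N" using p prime_gt_1_nat by auto
    have lnp: "ln (real p) > 0" "ln (real N) \<ge> 0" using p1 by auto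
    have "{d \<in> ?Q. aprimedivisor d = p} \<subseteq> (\<lambda>k. p ^ k) ` {1..K}"
    proof clarify
      fix d assume d: "d \<in> {1..N}" "primepow d" "p = aprimedivisor d"
      obtain q k where qk: "prime q" "k > 0" "d = q ^ k"
        using d(2) by (auto simp: primepow_def)
      have "aprimedivisor d = q" using qk by (simp add: aprimedivisor_prime_power)
      then have dk: "d = p ^ k" using d qk by simp
      have "real k * ln (real p) = ln (real d)" using dk p1 by (simp add: ln_realpow)
      also have "\<dots> \<le> ln (real N)" using d(1) by simp
      finally have "real k \<le> ln (real N) / ln (real p)" using lnp by (simp add: field_simps)
      then have "k \<le> K" unfolding K_def by (simp add: le_nat_floor)
      then have "d \<in> (\<lambda>k. p ^ k) ` {1..K}" using dk qk(2) by auto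
      then show "d \<in> (\<lambda>k. aprimedivisor d ^ k) ` {1..K}" using d(3) by simp
    qed
    then have "card {d \<in> ?Q. aprimedivisor d = p} \<le> card ((\<lambda>k. p ^ k) ` {1..K})"
      by (intro card_mono) auto
    also have "\<dots> \<le> K" using card_image_le[of "{1..K}"] by simp
    finally have c: "real (card {d \<in> ?Q. aprimedivisor d = p}) \<le> real K" by simp
    have "(\<Sum>d | d \<in> ?Q \<and> aprimedivisor d = p. ln (real (aprimedivisor d)))
        = real (card {d \<in> ?Q. aprimedivisor d = p}) * ln (real p)" by simp
    also have "\<dots> \<le> real K * ln (real p)" using c lnp by (intro mult_right_mono) auto
    also have "\<dots> \<le> (ln (real N) / ln (real p)) * ln (real p)"
      using lnp by (intro mult_right_mono) (auto simp: K_def)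
    also have "\<dots> = ln (real N)" using lnp by simp
    finally show "(\<Sum>d | d \<in> ?Q \<and> aprimedivisor d = p. ln (real (aprimedivisor d))) \<le> ln (real N)" .
  qed
  also have "\<dots> = real (prime_count N) * ln (real N)" by (simp add: prime_count_def)
  finally show ?thesis .
qed

lemma card_multiples:
  fixes d N :: nat
  assumes "d > 0"
  shows "card {k \<in> {1..N}. d dvd k} = N div d"
proof -
  have "{k \<in> {1..N}. d dvd k} = (\<lambda>j. d * j) ` {1..N div d}"
    using assms by (auto simp: dvd_def less_eq_div_iff_mult_less_eq mult.commute Suc_le_eq)
  also have "card \<dots> = card {1..N div d}"
    using assms by (intro card_image) (auto simp: inj_on_def)
  finally show ?thesis by simp
qed

text \<open>Each \<open>ln k\<close> is the sum of \<open>mangoldt\<close> over the divisors of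
  \<open>k\<close>, and \<open>d\<close> has \<open>N div d\<close> multiples up to
  \<open>N\<close>. Terms with \<open>d > N\<close> vanish; the free bound \<open>M\<close> lets two
  different factorials be expanded over one range.\<close>

lemma ln_fact_mangoldt:
  assumes "N \<le> M"
  shows "ln (fact N) = (\<Sum>d\<in>{1..M}. mangoldt d * real (N div d))"
proof -
  have "ln (fact N :: real) = (\<Sum>k\<in>{1..N}. ln (real k))"
    unfolding fact_prod of_nat_prod by (subst ln_prod) auto
  also have "\<dots> = (\<Sum>k\<in>{1..N}. \<Sum>d\<in>{1..M}. if d dvd k then mangoldt d else 0)"
  proof (intro sum.cong refl)
    fix k assume k: "k \<in> {1..N}"
    have "{d \<in> {1..M}. d dvd k} = {d. d dvd k}"
      using k assms by (auto dest: dvd_imp_le intro!: Nat.gr0I)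
    then have "(\<Sum>d\<in>{1..M}. if d dvd k then mangoldt d else 0) = (\<Sum>d | d dvd k. mangoldt d :: real)"
      by (simp flip: sum.inter_filter)
    also have "\<dots> = ln (real k)"
      using k mangoldt_sum[of k, where ?'a = real] by simp
    finally show "ln (real k) = (\<Sum>d\<in>{1..M}. if d dvd k then mangoldt d else 0)" ..
  qed
  also have "\<dots> = (\<Sum>d\<in>{1..M}. \<Sum>k\<in>{1..N}. if d dvd k then mangoldt d else 0)"
    by (rule sum.swap)
  also have "\<dots> = (\<Sum>d\<in>{1..M}. mangoldt d * real (N div d))"
  proof (intro sum.cong refl)
    fix d assume "d \<in> {1..M}"
    then show "(\<Sum>k\<in>{1..N}. if d dvd k then mangoldt d else 0) = mangoldt d * real (N div d)"
      using card_multiples[of d N] by (simp flip: sum.inter_filter)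
  qed
  finally show ?thesis .
qed

text \<open>After expanding the factorials, \<open>mangoldt d\<close> has the coefficient
  \<open>2 * n div d - 2 * (n div d)\<close>, which never exceeds 1.\<close>

lemma ln_central_binomial_le: "ln (real ((2 * n) choose n)) \<le> (\<Sum>d\<in>{1..2 * n}. mangoldt d)"
proof -
  have "real ((2 * n) choose n) = fact (2 * n) / (fact n * fact n)"
    by (subst binomial_fact) auto
  then have "ln (real ((2 * n) choose n)) = ln (fact (2 * n)) - 2 * ln (fact n)"
    by (simp add: ln_div ln_mult)
  also have "\<dots> = (\<Sum>d\<in>{1..2 * n}. mangoldt d * (real (2 * n div d) - 2 * real (n div d)))"
    by (subst (1 2) ln_fact_mangoldt[of _ "2 * n"])
       (auto simp: sum_distrib_left sum_subtractf algebra_simps)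
  also have "\<dots> \<le> (\<Sum>d\<in>{1..2 * n}. mangoldt d * 1)"
  proof (intro sum_mono mult_left_mono mangoldt_nonneg)
    fix d :: nat assume "d \<in> {1..2 * n}"
    then have "d > 0" by simp
    then have "2 * n < d * (2 * (n div d) + 2)"
      using dividend_less_times_div[of d n] by (simp add: algebra_simps)
    then have "2 * n div d < 2 * (n div d) + 2"
      using \<open>d > 0\<close> by (simp add: div_less_iff_less_mult mult.commute)
    then show "real (2 * n div d) - 2 * real (n div d) \<le> 1" by linarith
  qed
  finally show ?thesis by simp
qed

lemma prime_count_mono: "m \<le> n \<Longrightarrow> prime_count m \<le> prime_count n"
  unfolding prime_count_def by (intro card_mono) auto

text \<open>The central binomial coefficient is at least \<open>4 ^ n / (2 * n)\<close>. With
  \<open>n = N div 2\<close> and the crude \<open>ln 4 \<ge> 1\<close> this leaves about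
  \<open>N / 2\<close> for \<open>prime_count N * ln N\<close>; lowering it to \<open>N / 4\<close>
  absorbs the smaller terms.\<close>

lemma prime_count_lower_bound:
  "eventually (\<lambda>N. real N / (4 * ln (real N)) \<le> real (prime_count N)) sequentially"
proof -
  have bound: "(real N - 1) / 2 - ln (real N) \<le> real (prime_count N) * ln (real N)" if N: "N \<ge> 2" for N
  proof -
    define n where "n = N div 2"
    have n: "n > 0" "2 * n \<le> N" "N \<le> 2 * n + 1" using N by (auto simp: n_def)
    have "real n * ln 4 - ln (2 * real n) = ln (4 ^ n / (2 * real n))"
      using n by (simp add: ln_div ln_realpow)
    also have "\<dots> \<le> ln (real ((2 * n) choose n))"
      using central_binomial_lower_bound[OF n(1)] n by (subst ln_le_cancel_iff) auto
    also have "\<dots> \<le> (\<Sum>d\<in>{1..2 * n}. mangoldt d)" by (rule ln_central_binomial_le)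
    also have "\<dots> \<le> real (prime_count (2 * n)) * ln (real (2 * n))" by (rule sum_mangoldt_le)
    also have "\<dots> \<le> real (prime_count N) * ln (real N)"
      using n prime_count_mono[of "2 * n" N] by (intro mult_mono) auto
    finally have 1: "real n * ln 4 - ln (2 * real n) \<le> real (prime_count N) * ln (real N)" .
    have "ln 4 \<ge> (1 :: real)" using exp_le by (subst ln_ge_iff) auto
    then have "(real N - 1) / 2 * 1 \<le> real n * ln 4" using n by (intro mult_mono) auto
    moreover have "ln (2 * real n) \<le> ln (real N)" using n by simp
    ultimately show ?thesis using 1 by linarith
  qed
  have "eventually (\<lambda>N::nat. real N / 4 \<le> (real N - 1) / 2 - ln (real N)) sequentially"
    by real_asymp
  then show ?thesis using eventually_ge_at_top[of 2]
  proof eventually_elim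
    case (elim N)
    then have "real N / 4 \<le> real (prime_count N) * ln (real N)" using bound[of N] by linarith
    moreover have "ln (real N) > 0" using elim by simp
    ultimately show ?case by (simp add: field_simps)
  qed
qed

section \<open>Prime pairs with a given difference\<close>

definition prime_pairs :: "nat \<Rightarrow> nat set" where
  "prime_pairs h = {p. prime p \<and> h \<le> p \<and> prime (p - h)}"

text \<open>The sieve forbids 0 modulo every prime up to \<open>n\<close>, and also \<open>h\<close>
  modulo the primes of \<open>L\<close>; the two classes differ because \<open>l\<close> does not
  divide \<open>h\<close>. The summand \<open>2 * real n\<close> covers the pairs with a member up
  to \<open>n\<close>, which the sieve may remove.\<close>

lemma card_prime_pairs_le:
  fixes L :: "nat set" and h n N :: nat
  assumes L: "finite L" "\<And>l. l \<in> L \<Longrightarrow> prime l \<and> 3 \<le> l" "\<And>l. l \<in> L \<Longrightarrow> \<not> l dvd h"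
    and n: "\<Prod>L \<le> n"
  shows "real (card (prime_pairs h \<inter> {..N}))
    \<le> real (Suc N) / (harm (n div \<Prod>L) * (\<Prod>p\<in>L. 1 + 1 / (real p - 1))) + real n ^ 6 + 2 * real n"
proof -
  define Om where "Om = (\<lambda>p. if p \<in> L then {0, h mod p} else {0})"
  define w where "w = (\<lambda>p. (if p \<in> L then 2 else 1) / real p)"
  define Z where "Z = (\<lambda>m. {p. m mod p \<in> Om p})"
  define G where "G = {m \<in> {..<Suc N}. \<forall>S\<in>prime_sets n. S \<subseteq> Z m \<longrightarrow> S = {}}"
  have Om: "Om p \<subseteq> {..<p}" "real (card (Om p)) / real p = w p" if "prime p" for p
  proof -
    have "h mod p \<noteq> 0" if "p \<in> L" using L(3)[OF that] by (simp add: dvd_eq_mod_eq_0)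
    then show "Om p \<subseteq> {..<p}" "real (card (Om p)) / real p = w p"
      using \<open>prime p\<close> prime_gt_0_nat[of p] by (auto simp: Om_def w_def)
  qed
  have w: "0 < w p \<and> w p < 1 \<and> 1 / w p \<le> real p" if "prime p" for p
    using prime_gt_1_nat[OF that] L(2)[of p] by (auto simp: w_def field_simps)
  have Lpos: "\<Prod>L > 0" by (rule prod_primes_pos) (use L(2) in blast)
  have sieve: "real (card G) \<le> real (Suc N) / (\<Sum>S\<in>prime_sets n. \<Prod>p\<in>S. w p / (1 - w p))
      + (real (card (prime_sets n)) * real n)\<^sup>2 * real (n * n)"
    unfolding G_def
  proof (rule selberg_sieve)
    show "{} \<in> prime_sets n" using n Lpos by (auto simp: prime_sets_def)
  next
    fix S p assume "S \<in> prime_sets n" "p \<in> S"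
    then show "0 < w p \<and> w p < 1" using w prime_setsD(2) by blast
  next
    fix S T assume S: "S \<in> prime_sets n" and T: "T \<in> prime_sets n"
    have pr: "prime p" if "p \<in> S \<union> T" for p
      using that prime_setsD(2)[OF S] prime_setsD(2)[OF T] by blast
    have fin: "finite S" "finite T" using S T prime_setsD(1) by auto
    have "\<bar>real (card {m \<in> {..<Suc N}. \<forall>p\<in>S \<union> T. m mod p \<in> Om p})
        - real (Suc N) * (\<Prod>p\<in>S \<union> T. real (card (Om p)) / real p)\<bar> \<le> real (\<Prod>(S \<union> T))"
      using pr fin by (intro card_residue_conditions_interval Om(1)) auto
    also have "(\<Prod>p\<in>S \<union> T. real (card (Om p)) / real p) = (\<Prod>p\<in>S \<union> T. w p)"
      by (intro prod.cong refl Om(2) pr)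
    also have "{m \<in> {..<Suc N}. \<forall>p\<in>S \<union> T. m mod p \<in> Om p} = {m \<in> {..<Suc N}. S \<union> T \<subseteq> Z m}"
      by (auto simp: Z_def)
    also have "real (\<Prod>(S \<union> T)) \<le> real (n * n)"
    proof (rule of_nat_mono)
      have pos: "\<Prod>(S \<inter> T) > 0" by (rule prod_primes_pos) (use pr in blast)
      have "\<Prod>(S \<union> T) \<le> \<Prod>(S \<union> T) * \<Prod>(S \<inter> T)" using pos by simp
      also have "\<dots> = \<Prod>S * \<Prod>T" using fin by (rule prod.union_inter)
      also have "\<dots> \<le> n * n" using prime_setsD(3)[OF S] prime_setsD(3)[OF T] by (rule mult_le_mono)
      finally show "\<Prod>(S \<union> T) \<le> n * n" .
    qed
    finally show "\<bar>real (card {m \<in> {..<Suc N}. S \<union> T \<subseteq> Z m}) - real (Suc N) * (\<Prod>p\<in>S \<union> T. w p)\<bar>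
      \<le> real (n * n)" .
  next
    fix S assume S: "S \<in> prime_sets n"
    have "1 / (\<Prod>p\<in>S. w p) = (\<Prod>p\<in>S. 1 / w p)" by (simp add: prod_dividef)
    also have "\<dots> \<le> (\<Prod>p\<in>S. real p)"
    proof (intro prod_mono conjI)
      fix p assume "p \<in> S"
      then have "prime p" by (rule prime_setsD(2)[OF S])
      from w[OF this] show "0 \<le> 1 / w p" "1 / w p \<le> real p" by auto
    qed
    also have "\<dots> = real (\<Prod>S)" by simp
    also have "\<dots> \<le> real n" using prime_setsD(3)[OF S] by (rule of_nat_mono)
    finally show "1 / (\<Prod>p\<in>S. w p) \<le> real n" .
  qed (auto intro: prime_sets_subset prime_setsD(1))
  \<comment> \<open>A pair with both members above \<open>n\<close> survives: a prime
    \<open>q \<le> n\<close> dividing \<open>p\<close> or \<open>p - h\<close> would have to equal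
    that member.\<close>
  have sub: "prime_pairs h \<inter> {..N} \<subseteq> G \<union> {1..n} \<union> {h + 1..h + n}"
  proof
    fix p assume p: "p \<in> prime_pairs h \<inter> {..N}"
    show "p \<in> G \<union> {1..n} \<union> {h + 1..h + n}"
    proof (cases "p \<le> n \<or> p - h \<le> n")
      case True
      then show ?thesis using p prime_gt_0_nat[of p] prime_gt_0_nat[of "p - h"]
        by (auto simp: prime_pairs_def)
    next
      case False
      have "S = {}" if S: "S \<in> prime_sets n" "S \<subseteq> Z p" for S
      proof (rule ccontr)
        assume "S \<noteq> {}"
        then obtain q where q: "q \<in> S" by auto
        have qp: "prime q" "q \<le> n" using S(1) q by (auto simp: prime_sets_def)
        have "p mod q \<in> Om q" using S(2) q by (auto simp: Z_def)
        then consider "q dvd p" | "p mod q = h mod q"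
          by (auto simp: Om_def dvd_eq_mod_eq_0 split: if_splits)
        then show False
        proof cases
          case 1
          then have "q = p" using qp(1) p by (intro primes_dvd_imp_eq) (auto simp: prime_pairs_def)
          with qp(2) False show False by simp
        next
          case 2
          have "q dvd p - h" using 2 p by (simp add: mod_eq_dvd_iff_nat prime_pairs_def)
          then have "q = p - h" using qp(1) p by (intro primes_dvd_imp_eq) (auto simp: prime_pairs_def)
          with qp(2) False show False by simp
        qed
      qed
      then have "p \<in> G" using p by (auto simp: G_def)
      then show ?thesis by blast
    qed
  qed
  have finG: "finite G" by (simp add: G_def)
  have "card (prime_pairs h \<inter> {..N}) \<le> card (G \<union> {1..n} \<union> {h + 1..h + n})"
    using sub finG by (intro card_mono) auto
  also have "\<dots> \<le> card G + card {1..n} + card {h + 1..h + n}"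
    by (intro order_trans[OF card_Un_le] add_mono) auto
  finally have "real (card (prime_pairs h \<inter> {..N})) \<le> real (card G + 2 * n)"
    by (intro of_nat_mono) simp
  moreover have "real (Suc N) / (\<Sum>S\<in>prime_sets n. \<Prod>p\<in>S. w p / (1 - w p))
      \<le> real (Suc N) / (harm (n div \<Prod>L) * (\<Prod>p\<in>L. 1 + 1 / (real p - 1)))"
  proof (rule divide_left_mono)
    have "n div \<Prod>L > 0" using n Lpos by (simp add: div_greater_zero_iff)
    then have "harm (n div \<Prod>L) > (0 :: real)" by (rule harm_pos)
    moreover have "(\<Prod>p\<in>L. 1 + 1 / (real p - 1)) > 0"
    proof (rule prod_pos)
      fix p assume "p \<in> L"
      then have "real p \<ge> 3" using L(2) by fastforce
      then show "1 + 1 / (real p - 1) > 0" by (intro add_pos_pos) auto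
    qed
    ultimately have pos: "harm (n div \<Prod>L) * (\<Prod>p\<in>L. 1 + 1 / (real p - 1)) > 0"
      by (rule mult_pos_pos)
    show le: "harm (n div \<Prod>L) * (\<Prod>p\<in>L. 1 + 1 / (real p - 1))
        \<le> (\<Sum>S\<in>prime_sets n. \<Prod>p\<in>S. w p / (1 - w p))"
      unfolding w_def using L(1,2) by (rule selberg_sum_lower_bound)
    show "(\<Sum>S\<in>prime_sets n. \<Prod>p\<in>S. w p / (1 - w p))
        * (harm (n div \<Prod>L) * (\<Prod>p\<in>L. 1 + 1 / (real p - 1))) > 0"
      by (rule mult_pos_pos[OF less_le_trans[OF pos le] pos])
  qed simp
  \<comment> \<open>The exponent 6 arises from at most \<open>n\<close> sets and weights at most
    \<open>n\<close>, both squared, and from products over \<open>S \<union> T\<close> up to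
    \<open>n * n\<close>.\<close>
  moreover have "(real (card (prime_sets n)) * real n)\<^sup>2 * real (n * n) \<le> real n ^ 6"
  proof -
    have "real (card (prime_sets n)) * real n \<le> real n * real n"
      using card_prime_sets[of n] by (intro mult_right_mono) auto
    then have "(real (card (prime_sets n)) * real n)\<^sup>2 \<le> (real n * real n)\<^sup>2"
      by (rule power_mono) simp
    then have "(real (card (prime_sets n)) * real n)\<^sup>2 * real (n * n) \<le> (real n * real n)\<^sup>2 * real (n * n)"
      by (rule mult_right_mono) simp
    then show ?thesis by (simp add: power2_eq_square power_numeral_reduce algebra_simps)
  qed
  ultimately show ?thesis using sieve by simp
qed

text \<open>The sieve level is about \<open>N powr (1/12)\<close>, which keeps \<open>n ^ 6\<close>
  below \<open>sqrt N\<close>. Its logarithm is \<open>ln N / 12\<close>, so the main term is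
  asymptotically \<open>12 / K * (N / ln N)\<close>; 15 absorbs the rest, and Chebyshev's constant 4
  turns it into 60. \<open>h\<close> is quantified inside because \<open>N0\<close> must not depend
  on it.\<close>

lemma prime_pairs_uniform_bound:
  fixes L :: "nat set"
  assumes L: "finite L" "\<And>l. l \<in> L \<Longrightarrow> prime l \<and> 3 \<le> l"
  shows "\<exists>N0. \<forall>N\<ge>N0. \<forall>h. (\<forall>l\<in>L. \<not> l dvd h) \<longrightarrow>
    real (card (prime_pairs h \<inter> {..N})) \<le> 60 / (\<Prod>p\<in>L. 1 + 1 / (real p - 1)) * real (prime_count N)"
proof -
  define K where "K = (\<Prod>p\<in>L. 1 + 1 / (real p - 1))"
  define C where "C = real (\<Prod>L)"
  have Kpos: "K > 0"
    unfolding K_def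
  proof (rule prod_pos)
    fix p assume "p \<in> L"
    then have "real p \<ge> 3" using L(2) by fastforce
    then show "1 + 1 / (real p - 1) > 0" by (intro add_pos_pos) auto
  qed
  have Lpos: "\<Prod>L > 0" by (rule prod_primes_pos) (use L(2) in blast)
  then have Cpos: "C > 0" unfolding C_def by (simp only: of_nat_0_less_iff)
  have "eventually (\<lambda>N::nat. (real N + 1) / (ln ((real N powr (1/12) - 1) / C) * K) + sqrt (real N)
      + 2 * real N powr (1/12) \<le> 15 / K * (real N / ln (real N))) sequentially"
    using Kpos Cpos by real_asymp
  moreover have "eventually (\<lambda>N::nat. (real N powr (1/12) - 1) / C > 1) sequentially"
    using Cpos by real_asymp
  ultimately have "eventually (\<lambda>N. \<forall>h. (\<forall>l\<in>L. \<not> l dvd h) \<longrightarrow>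
    real (card (prime_pairs h \<inter> {..N})) \<le> 60 / K * real (prime_count N)) sequentially"
    using prime_count_lower_bound
  proof eventually_elim
    case (elim N)
    define x where "x = real N powr (1/12)"
    define n where "n = nat \<lfloor>x\<rfloor>"
    have x0: "x \<ge> 0" by (simp add: x_def)
    have nx: "real n \<le> x" "x - 1 \<le> real n" using x0 by (auto simp: n_def)
    have "C < x - 1" using elim(2) Cpos by (simp add: x_def field_simps)
    then have Cn: "C \<le> real n" using nx by linarith
    then have Ln: "\<Prod>L \<le> n" unfolding C_def by (simp only: of_nat_le_iff)
    have "n < \<Prod>L * (n div \<Prod>L + 1)"
      using dividend_less_times_div[OF Lpos, of n] by simp
    then have "real n \<le> C * (real (n div \<Prod>L) + 1)"
      unfolding C_def by (metis less_imp_le of_nat_1 of_nat_add of_nat_le_iff of_nat_mult)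
    then have "(x - 1) / C \<le> real (n div \<Prod>L) + 1"
      using nx Cpos by (simp add: field_simps)
    then have "ln ((x - 1) / C) \<le> ln (real (n div \<Prod>L) + 1)"
      using elim(2) by (subst ln_le_cancel_iff) (auto simp: x_def)
    also have "\<dots> \<le> harm (n div \<Prod>L)" by (rule ln_le_harm)
    finally have harm: "ln ((x - 1) / C) \<le> harm (n div \<Prod>L)" .
    have lnpos: "ln ((x - 1) / C) > 0" using elim(2) by (simp add: x_def)
    have "real n ^ 6 \<le> x ^ 6" using nx by (intro power_mono) auto
    also have "x ^ 6 = sqrt (real N)"
    proof (cases "N = 0")
      case False
      then have "x ^ 6 = real N powr (1/2)" by (simp add: x_def powr_power)
      then show ?thesis by (simp add: powr_half_sqrt)
    qed (simp add: x_def)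
    finally have n6: "real n ^ 6 \<le> sqrt (real N)" .
    show ?case
    proof (intro allI impI)
      fix h assume h: "\<forall>l\<in>L. \<not> l dvd h"
      have "real (card (prime_pairs h \<inter> {..N}))
          \<le> real (Suc N) / (harm (n div \<Prod>L) * K) + real n ^ 6 + 2 * real n"
        unfolding K_def using L h Ln by (intro card_prime_pairs_le) auto
      also have "\<dots> \<le> (real N + 1) / (ln ((x - 1) / C) * K) + sqrt (real N) + 2 * x"
      proof (intro add_mono)
        have "ln ((x - 1) / C) * K \<le> harm (n div \<Prod>L) * K"
          using harm Kpos by (intro mult_right_mono) auto
        moreover have "ln ((x - 1) / C) * K > 0" using lnpos Kpos by (rule mult_pos_pos)
        ultimately show "real (Suc N) / (harm (n div \<Prod>L) * K) \<le> (real N + 1) / (ln ((x - 1) / C) * K)"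
          by (intro frac_le) auto
      qed (use n6 nx in auto)
      also have "\<dots> \<le> 15 / K * (real N / ln (real N))" using elim(1) by (simp add: x_def)
      also have "\<dots> = 60 / K * (real N / (4 * ln (real N)))" by simp
      also have "\<dots> \<le> 60 / K * real (prime_count N)"
        using elim(3) Kpos by (intro mult_left_mono) auto
      finally show "real (card (prime_pairs h \<inter> {..N})) \<le> 60 / K * real (prime_count N)" .
    qed
  qed
  then show ?thesis unfolding eventually_sequentially K_def .
qed

text \<open>Euler's argument: the product over all primes up to \<open>y\<close> is at least
  \<open>harm y\<close>, which diverges. Discarding the primes up to \<open>max n 2\<close> costs a
  factor independent of \<open>y\<close>.\<close>

lemma prod_primes_one_plus_unbounded:
  "\<exists>L :: nat set. finite L \<and> (\<forall>p\<in>L. prime p \<and> 3 \<le> p \<and> n < p) \<and> K \<le> (\<Prod>p\<in>L. 1 + 1 / (real p - 1))"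
proof -
  define f where "f = (\<lambda>p::nat. 1 + 1 / (real p - 1))"
  define n' where "n' = max n 2"
  define Q where "Q = {p. prime p \<and> p \<le> n'}"
  have finQ: "finite Q" by (simp add: Q_def)
  have f1: "f p \<ge> 1" if "prime p" for p
    using prime_gt_1_nat[OF that] by (simp add: f_def)
  have Qpos: "prod f Q > 0"
  proof (rule prod_pos)
    fix p assume "p \<in> Q"
    then show "f p > 0" using f1[of p] by (simp add: Q_def)
  qed
  obtain y :: nat where y: "harm y \<ge> K * prod f Q"
  proof -
    have "filterlim (harm :: nat \<Rightarrow> real) at_top sequentially" by (rule harm_at_top)
    then have "eventually (\<lambda>y. harm y \<ge> K * prod f Q) sequentially"
      by (simp add: filterlim_at_top)
    then show ?thesis using that by (auto simp: eventually_sequentially)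
  qed
  define P where "P = {p. prime p \<and> p \<le> y}"
  have finP: "finite P" by (simp add: P_def)
  have "K * prod f Q \<le> harm y" by (rule y)
  also have "harm y \<le> (\<Sum>U\<in>prime_sets y. \<Prod>p\<in>U. 1 / (real p - 1))"
    by (rule harm_le_sum_prime_sets)
  also have "\<dots> \<le> (\<Sum>U\<in>Pow P. \<Prod>p\<in>U. 1 / (real p - 1))"
  proof (rule sum_mono2)
    show "prime_sets y \<subseteq> Pow P" by (auto simp: prime_sets_def P_def)
  next
    fix U assume "U \<in> Pow P - prime_sets y"
    then have "\<forall>p\<in>U. prime p" by (auto simp: P_def)
    then show "(\<Prod>p\<in>U. 1 / (real p - 1)) \<ge> 0"
      using prime_ge_1_nat by (intro prod_nonneg) auto
  qed (use finP in simp)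
  also have "\<dots> = prod f P"
    unfolding f_def by (rule prod_one_plus[OF finP, symmetric])
  also have "\<dots> = prod f (P \<inter> Q) * prod f (P - Q)"
    by (rule prod.Int_Diff[OF finP])
  also have "\<dots> \<le> prod f Q * prod f (P - Q)"
  proof (rule mult_right_mono)
    show "prod f (P \<inter> Q) \<le> prod f Q"
    proof (rule prod_mono2[OF finQ])
      fix p assume "p \<in> Q - P \<inter> Q" then show "1 \<le> f p" using f1 by (simp add: Q_def)
    next
      fix p assume "p \<in> P \<inter> Q" then show "0 \<le> f p" using f1[of p] by (simp add: Q_def)
    qed auto
    show "prod f (P - Q) \<ge> 0"
    proof (rule prod_nonneg)
      fix p assume "p \<in> P - Q" then show "0 \<le> f p" using f1[of p] by (simp add: P_def)
    qed
  qed
  finally have "K \<le> prod f (P - Q)" using Qpos by (simp add: mult.commute)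
  moreover have "\<forall>p\<in>P - Q. prime p \<and> 3 \<le> p \<and> n < p"
    by (auto simp: P_def Q_def n'_def)
  ultimately show ?thesis using finP unfolding f_def by blast
qed

text \<open>Primes exceeding \<open>h\<close> cannot divide it, so \<open>L\<close> may be taken
  among them with as large a saving as desired.\<close>

lemma prime_pairs_relative_density_zero:
  assumes "h > 0" "e > 0"
  shows "eventually (\<lambda>N. real (card (prime_pairs h \<inter> {..N})) \<le> e * real (prime_count N)) sequentially"
proof -
  obtain L :: "nat set" where L: "finite L" "\<forall>p\<in>L. prime p \<and> 3 \<le> p \<and> h < p"
    "60 / e \<le> (\<Prod>p\<in>L. 1 + 1 / (real p - 1))"
    using prod_primes_one_plus_unbounded[of h "60 / e"] by blast
  define K where "K = (\<Prod>p\<in>L. 1 + 1 / (real p - 1))"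
  have "0 < 60 / e" using assms by simp
  then have "K > 0" using L(3) unfolding K_def by linarith
  then have K: "60 / K \<le> e" using L(3) assms by (simp add: K_def[symmetric] field_simps)
  have h: "\<forall>l\<in>L. \<not> l dvd h" using L(2) assms(1) by (meson dvd_imp_le not_le)
  obtain N0 where "\<forall>N\<ge>N0. \<forall>h. (\<forall>l\<in>L. \<not> l dvd h) \<longrightarrow>
    real (card (prime_pairs h \<inter> {..N})) \<le> 60 / K * real (prime_count N)"
    using prime_pairs_uniform_bound[of L] L(1,2) unfolding K_def by blast
  then have "real (card (prime_pairs h \<inter> {..N})) \<le> 60 / K * real (prime_count N)" if "N \<ge> N0" for N
    using h that by blast
  moreover have "60 / K * real (prime_count N) \<le> e * real (prime_count N)" for N
    using K by (rule mult_right_mono) simp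
  ultimately show ?thesis unfolding eventually_sequentially by (meson order_trans)
qed

text \<open>A bound at every \<open>N\<close>, with no exceptional range depending on the interval,
  is what allows infinitely many of these sets to be united later.\<close>

lemma prime_pairs_long_interval:
  assumes "e > 0"
  shows "\<exists>m\<ge>m0. \<forall>N. real (card ((\<Union>h\<in>{m<..m + n}. prime_pairs h) \<inter> {..N})) \<le> e * real (prime_count N)"
proof -
  \<comment> \<open>The factor \<open>real n + 1\<close> pays for the \<open>n\<close> differences
    in the interval, and its 1 keeps the bound positive for \<open>n = 0\<close>.\<close>
  obtain L :: "nat set" where L: "finite L" "\<forall>p\<in>L. prime p \<and> 3 \<le> p \<and> n < p"
    "60 * (real n + 1) / e \<le> (\<Prod>p\<in>L. 1 + 1 / (real p - 1))"
    using prod_primes_one_plus_unbounded[of n "60 * (real n + 1) / e"] by blast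
  define K where "K = (\<Prod>p\<in>L. 1 + 1 / (real p - 1))"
  have "0 < 60 * (real n + 1) / e" using assms by simp
  then have Kpos: "K > 0" using L(3) unfolding K_def by linarith
  have "60 * (real n + 1) \<le> e * K" using L(3) assms by (simp add: K_def[symmetric] field_simps)
  then have K: "real n * (60 / K) \<le> e" using Kpos by (simp add: field_simps)
  obtain N0 where N0: "\<forall>N\<ge>N0. \<forall>h. (\<forall>l\<in>L. \<not> l dvd h) \<longrightarrow>
    real (card (prime_pairs h \<inter> {..N})) \<le> 60 / K * real (prime_count N)"
    using prime_pairs_uniform_bound[of L] L(1,2) unfolding K_def by blast
  \<comment> \<open>Each \<open>l \<in> L\<close> divides \<open>m\<close> and exceeds
    \<open>n\<close>, hence cannot divide \<open>h\<close> when \<open>0 < h - m \<le> n\<close>.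
    The factor \<open>m0 + N0\<close> supplies both lower bounds on \<open>m\<close>.\<close>
  define m where "m = \<Prod>L * (m0 + N0)"
  have "\<Prod>L > 0" by (rule prod_primes_pos) (use L(2) in blast)
  then have "m0 + N0 \<le> m" by (simp add: m_def)
  then have m: "m \<ge> m0" "m \<ge> N0" by auto
  have ndvd: "\<not> l dvd h" if "h \<in> {m<..m + n}" "l \<in> L" for h l
  proof
    assume "l dvd h"
    moreover have "l dvd m" using that(2) L(1) unfolding m_def by (intro dvd_mult2 dvd_prodI)
    ultimately have "l dvd h - m" by (rule dvd_diff_nat)
    then have "l \<le> h - m" using that(1) by (intro dvd_imp_le) auto
    then show False using that L(2) by fastforce
  qed
  have "real (card ((\<Union>h\<in>{m<..m + n}. prime_pairs h) \<inter> {..N})) \<le> e * real (prime_count N)" for N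
  proof (cases "N \<ge> N0")
    case True
    have "card ((\<Union>h\<in>{m<..m + n}. prime_pairs h) \<inter> {..N}) \<le> (\<Sum>h\<in>{m<..m + n}. card (prime_pairs h \<inter> {..N}))"
      unfolding UN_extend_simps by (rule card_UN_le) simp
    then have "real (card ((\<Union>h\<in>{m<..m + n}. prime_pairs h) \<inter> {..N}))
      \<le> real (\<Sum>h\<in>{m<..m + n}. card (prime_pairs h \<inter> {..N}))" by (rule of_nat_mono)
    also have "\<dots> \<le> (\<Sum>h\<in>{m<..m + n}. 60 / K * real (prime_count N))"
      unfolding of_nat_sum using N0 True ndvd by (intro sum_mono) blast
    also have "\<dots> = (real n * (60 / K)) * real (prime_count N)" by simp
    also have "\<dots> \<le> e * real (prime_count N)" using K by (rule mult_right_mono) simp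
    finally show ?thesis .
  next
    case False
    then have "(\<Union>h\<in>{m<..m + n}. prime_pairs h) \<inter> {..N} = {}"
      using m by (auto simp: prime_pairs_def)
    then show ?thesis using assms by simp
  qed
  then show ?thesis using m(1) by blast
qed

text \<open>The sets with index up to \<open>k\<close> involve finitely many differences, each of
  relative density zero. The remaining sets are bounded by a geometric series, uniformly in
  \<open>N\<close>.\<close>

lemma sparse_prime_pairs:
  obtains m :: "nat \<Rightarrow> nat" where
    "\<And>e. e > 0 \<Longrightarrow> eventually (\<lambda>N. real (card ((\<Union>n. \<Union>h\<in>{m n<..m n + n}. prime_pairs h) \<inter> {..N}))
       \<le> e * real (prime_count N)) sequentially"
proof -
  \<comment> \<open>All elements of the set with index \<open>n\<close> exceed \<open>m n\<close>.
    Asking for \<open>m n \<ge> n\<close> thus lets only finitely many of these sets meet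
    \<open>{..N}\<close>.\<close>
  have "\<forall>n. \<exists>m\<ge>n. \<forall>N. real (card ((\<Union>h\<in>{m<..m + n}. prime_pairs h) \<inter> {..N})) \<le> (1/2) ^ n * real (prime_count N)"
    by (intro allI prime_pairs_long_interval) simp
  then obtain m where m: "\<And>n. m n \<ge> n"
    "\<And>n N. real (card ((\<Union>h\<in>{m n<..m n + n}. prime_pairs h) \<inter> {..N})) \<le> (1/2) ^ n * real (prime_count N)"
    by metis
  define B where "B = (\<lambda>n. \<Union>h\<in>{m n<..m n + n}. prime_pairs h)"
  have "eventually (\<lambda>N. real (card ((\<Union>n. B n) \<inter> {..N})) \<le> e * real (prime_count N)) sequentially"
    if e: "e > 0" for e
  proof -
    obtain k where k: "(1/2 :: real) ^ k < e / 2" using e real_arch_pow_inv[of "e/2" "1/2"] by auto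
    define H where "H = (\<Union>n\<in>{..k}. {m n<..m n + n})"
    have finH: "finite H" by (simp add: H_def)
    \<comment> \<open>The differences in \<open>H\<close> share one half of \<open>e\<close>; the
      added 1 covers an empty \<open>H\<close>.\<close>
    define d where "d = e / (2 * (real (card H) + 1))"
    have d: "d > 0" "real (card H) * d \<le> e / 2" using e by (auto simp: d_def field_simps)
    have "eventually (\<lambda>N. \<forall>h\<in>H. real (card (prime_pairs h \<inter> {..N})) \<le> d * real (prime_count N)) sequentially"
      using finH d(1) by (intro eventually_ball_finite ballI prime_pairs_relative_density_zero)
        (auto simp: H_def)
    then show ?thesis
    proof eventually_elim
      case (elim N)
      \<comment> \<open>Indices up to \<open>N\<close> matter, but the range ends at
        \<open>k + N\<close> so that the geometric sum has a closed form by induction on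
        \<open>N\<close>.\<close>
      have "(\<Union>n. B n) \<inter> {..N} \<subseteq> (\<Union>h\<in>H. prime_pairs h \<inter> {..N}) \<union> (\<Union>n\<in>{Suc k..k + N}. B n \<inter> {..N})"
      proof
        fix p assume p: "p \<in> (\<Union>n. B n) \<inter> {..N}"
        then obtain n where n: "p \<in> B n" "p \<le> N" by blast
        show "p \<in> (\<Union>h\<in>H. prime_pairs h \<inter> {..N}) \<union> (\<Union>n\<in>{Suc k..k + N}. B n \<inter> {..N})"
        proof (cases "n \<le> k")
          case True
          then show ?thesis using n by (auto simp: B_def H_def)
        next
          case False
          have "m n < p" using n(1) by (auto simp: B_def prime_pairs_def)
          then have "n \<le> N" using m(1)[of n] n(2) by simp
          then show ?thesis using False n by auto
        qed
      qed
      then have "card ((\<Union>n. B n) \<inter> {..N})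
          \<le> card ((\<Union>h\<in>H. prime_pairs h \<inter> {..N}) \<union> (\<Union>n\<in>{Suc k..k + N}. B n \<inter> {..N}))"
        using finH by (intro card_mono) auto
      also have "\<dots> \<le> (\<Sum>h\<in>H. card (prime_pairs h \<inter> {..N})) + (\<Sum>n\<in>{Suc k..k + N}. card (B n \<inter> {..N}))"
        using finH by (intro order_trans[OF card_Un_le] add_mono card_UN_le) auto
      finally have "real (card ((\<Union>n. B n) \<inter> {..N}))
        \<le> real ((\<Sum>h\<in>H. card (prime_pairs h \<inter> {..N})) + (\<Sum>n\<in>{Suc k..k + N}. card (B n \<inter> {..N})))"
        by (rule of_nat_mono)
      also have "\<dots> \<le> (\<Sum>h\<in>H. d * real (prime_count N)) + (\<Sum>n\<in>{Suc k..k + N}. (1/2) ^ n * real (prime_count N))"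
        unfolding of_nat_add of_nat_sum B_def using elim m(2) by (intro add_mono sum_mono) auto
      also have "\<dots> = (real (card H) * d + (\<Sum>n\<in>{Suc k..k + N}. (1/2) ^ n)) * real (prime_count N)"
        unfolding distrib_right sum_distrib_right by simp
      also have "\<dots> \<le> e * real (prime_count N)"
      proof (rule mult_right_mono)
        have "(\<Sum>n\<in>{Suc k..k + N}. (1/2 :: real) ^ n) = (1/2) ^ k - (1/2) ^ (k + N)"
          by (induction N) simp_all
        also have "\<dots> \<le> (1/2) ^ k" by simp
        finally show "real (card H) * d + (\<Sum>n\<in>{Suc k..k + N}. (1/2) ^ n) \<le> e" using d(2) k by linarith
      qed simp
      finally show ?case .
    qed
  qed
  then show ?thesis using that[of m] unfolding B_def by blast
qed

section \<open>Thick sets and the theorem\<close>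

text \<open>If \<open>b\<close> bounds the absolute values in \<open>F\<close>, the midpoint of an
  interval of length \<open>2 * b\<close> that misses \<open>S\<close> cannot be
  \<open>s - f\<close>, since \<open>s\<close> would be within \<open>b\<close> of the
  midpoint.\<close>

lemma not_syndetic_if_thick_complement:
  assumes "thick (Npos - S)"
  shows "\<not> syndetic S"
proof
  assume "syndetic S"
  then obtain F where F: "finite F" "Npos \<subseteq> diff_set (S \<inter> Npos) F" by (auto simp: syndetic_def)
  obtain b :: nat where b: "\<forall>f\<in>F. \<bar>f\<bar> \<le> int b"
  proof
    show "\<forall>f\<in>F. \<bar>f\<bar> \<le> int (nat (\<Sum>f\<in>F. \<bar>f\<bar>))"
    proof
      fix f assume "f \<in> F"
      then have "\<bar>f\<bar> \<le> (\<Sum>f\<in>F. \<bar>f\<bar>)" using F(1) by (intro member_le_sum) auto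
      then show "\<bar>f\<bar> \<le> int (nat (\<Sum>f\<in>F. \<bar>f\<bar>))" by linarith
    qed
  qed
  obtain m where m: "{m..m + int (2 * b)} \<subseteq> (Npos - S) \<inter> Npos"
    using assms unfolding thick_def by blast
  have "m \<in> Npos" using m by auto
  then have "m + int b \<in> Npos" by (auto simp: Npos_def)
  then obtain s f where sf: "s \<in> S" "f \<in> F" "m + int b = s - f"
    using F(2) by (auto simp: diff_set_def)
  have "\<bar>f\<bar> \<le> int b" using b sf(2) by blast
  then have "s \<in> {m..m + int (2 * b)}" using sf(3) by auto
  then show False using m sf(1) by blast
qed

text \<open>The chain is built greedily: from \<open>x\<close> it moves on by \<open>c x\<close>,
  where \<open>{c x..c x + x}\<close> lies in \<open>R\<close>. All earlier terms are in
  \<open>{0..x}\<close>, so their differences to the new term fall into this interval.\<close>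

lemma thick_difference_chain:
  assumes "thick R"
  shows "\<exists>r :: nat \<Rightarrow> int. r 0 = 0 \<and> (\<forall>i j. i < j \<longrightarrow> r j - r i \<in> R \<and> r i < r j)"
proof -
  have "\<forall>x::int. \<exists>y. {y..y + x} \<subseteq> R \<inter> Npos \<and> y \<in> Npos"
  proof
    fix x :: int
    obtain y where "{y..y + int (nat x)} \<subseteq> R \<inter> Npos" using assms unfolding thick_def by blast
    moreover have "y \<in> {y..y + int (nat x)}" by simp
    moreover have "{y..y + x} \<subseteq> {y..y + int (nat x)}" by auto
    ultimately show "\<exists>y. {y..y + x} \<subseteq> R \<inter> Npos \<and> y \<in> Npos" by blast
  qed
  then obtain c where c: "\<And>x::int. {c x..c x + x} \<subseteq> R \<inter> Npos" "\<And>x. c x \<in> Npos" by metis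
  define r where "r = rec_nat 0 (\<lambda>_ x. x + c x)"
  have r: "r 0 = 0" "\<And>n. r (Suc n) = r n + c (r n)" by (auto simp: r_def)
  have step: "r n < r (Suc n)" for n using c(2)[of "r n"] by (simp add: r Npos_def)
  then have mono: "r i < r j" if "i < j" for i j using that by (rule lift_Suc_mono_less)
  have nonneg: "r i \<ge> 0" for i using mono[of 0 i] r(1) by (cases "i = 0") auto
  have "r j - r i \<in> R" if "i < j" for i j
  proof (cases j)
    case (Suc k)
    then have "r i \<le> r k" using that mono[of i k] by (cases "i = k") auto
    then have "r j - r i \<in> {c (r k)..c (r k) + r k}" using nonneg[of i] by (auto simp: Suc r)
    then show ?thesis using c(1) by blast
  qed (use that in auto)
  then show ?thesis using r(1) mono by blast
qed

text \<open>The translates of \<open>A\<close> by the members of a chain as above would be disjoint.\<close>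

lemma intersective_if_thick:
  assumes "thick R"
  shows "intersective R"
  unfolding intersective_def intersective_wrt_def
proof (intro allI impI, elim conjE)
  fix A assume A: "A \<subseteq> Npos" and dens: "upper_rel_density Npos A > 0"
  obtain r :: "nat \<Rightarrow> int" where r: "r 0 = 0" "\<And>i j. i < j \<Longrightarrow> r j - r i \<in> R" "\<And>i j. i < j \<Longrightarrow> r i < r j"
    using thick_difference_chain[OF assms] by blast
  obtain d where d: "0 < ereal d" "ereal d < upper_rel_density Npos A"
    using ereal_dense2[OF dens] by auto
  have freq: "rel_freq Npos A N = real (card (A \<inter> {1..int N})) / real N" for N
  proof -
    have "Npos \<inter> {1..int N} = {1..int N}" "A \<inter> Npos \<inter> {1..int N} = A \<inter> {1..int N}"
      using A by (auto simp: Npos_def)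
    then show ?thesis by (simp add: rel_freq_def)
  qed
  show "R \<inter> diff_set A A \<noteq> {}"
  proof (rule ccontr)
    assume neg: "\<not> R \<inter> diff_set A A \<noteq> {}"
    \<comment> \<open>The \<open>k\<close> disjoint translates of \<open>A \<inter> {1..N}\<close>
      fit into \<open>{1..N + r k}\<close>, which has at most \<open>2 * N\<close> elements once
      \<open>N \<ge> r k\<close>. A frequency above \<open>d\<close> at such an \<open>N\<close>
      would force \<open>k * d < 2\<close>.\<close>
    obtain k :: nat where k: "real k * d > 2" "k > 0"
    proof -
      obtain k :: nat where "real k > 2 / d" using reals_Archimedean2 by blast
      moreover have "2 / d > 0" using d(1) by simp
      ultimately have "real k > 0" by linarith
      then have "k > 0" by simp
      moreover have "real k * d > 2" using \<open>real k > 2 / d\<close> d(1) by (simp add: field_simps)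
      ultimately show ?thesis using that by blast
    qed
    have rk: "0 \<le> r i" "r i \<le> r k" if "i < k" for i
      using that r(1) r(3)[of 0 i] r(3)[of i k] by (cases "i = 0"; auto)+
    have disj: "(\<lambda>a. a + r i) ` A \<inter> (\<lambda>a. a + r j) ` A = {}" if "i < j" for i j
    proof (rule ccontr)
      assume "(\<lambda>a. a + r i) ` A \<inter> (\<lambda>a. a + r j) ` A \<noteq> {}"
      then obtain a b where ab: "a \<in> A" "b \<in> A" "a + r i = b + r j" by auto
      then have "r j - r i = a - b" by simp
      moreover have "a - b \<in> diff_set A A" using ab(1,2) unfolding diff_set_def by blast
      ultimately show False using neg r(2)[OF that] by auto
    qed
    have count: "real k * real (card (A \<inter> {1..int N})) \<le> real N + real_of_int (r k)" for N
    proof -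
      have "k * card (A \<inter> {1..int N}) = (\<Sum>i<k. card ((\<lambda>a. a + r i) ` (A \<inter> {1..int N})))"
        by (simp add: card_image)
      also have "\<dots> = card (\<Union>i<k. (\<lambda>a. a + r i) ` (A \<inter> {1..int N}))"
      proof (rule card_UN_disjoint[symmetric])
        show "\<forall>i\<in>{..<k}. \<forall>j\<in>{..<k}. i \<noteq> j \<longrightarrow>
          (\<lambda>a. a + r i) ` (A \<inter> {1..int N}) \<inter> (\<lambda>a. a + r j) ` (A \<inter> {1..int N}) = {}"
        proof (intro ballI impI)
          fix i j :: nat assume "i \<noteq> j"
          then have "(\<lambda>a. a + r i) ` A \<inter> (\<lambda>a. a + r j) ` A = {}"
            using disj[of i j] disj[of j i] by (cases "i < j") auto
          then show "(\<lambda>a. a + r i) ` (A \<inter> {1..int N}) \<inter> (\<lambda>a. a + r j) ` (A \<inter> {1..int N}) = {}"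
            by blast
        qed
      qed auto
      also have "\<dots> \<le> card {1..int N + r k}"
      proof (rule card_mono)
        show "(\<Union>i<k. (\<lambda>a. a + r i) ` (A \<inter> {1..int N})) \<subseteq> {1..int N + r k}"
          using rk by fastforce
      qed simp
      finally have "k * card (A \<inter> {1..int N}) \<le> nat (int N + r k)" by simp
      then have "real (k * card (A \<inter> {1..int N})) \<le> real (nat (int N + r k))" by (rule of_nat_mono)
      then show ?thesis using r(1) r(3)[of 0 k] k(2) by simp
    qed
    have "eventually (\<lambda>N. ereal (rel_freq Npos A N) \<le> ereal d) sequentially"
      using eventually_ge_at_top[of "nat (r k) + 1"]
    proof eventually_elim
      case (elim N)
      then have N: "real_of_int (r k) \<le> real N" "real N > 0" by auto
      have "real k * real (card (A \<inter> {1..int N})) \<le> 2 * real N" using count[of N] N by linarith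
      also have "\<dots> \<le> (real k * d) * real N" using k(1) N by (intro mult_right_mono) auto
      finally have "real k * real (card (A \<inter> {1..int N})) \<le> real k * (d * real N)" by (simp only: mult.assoc)
      then have "real (card (A \<inter> {1..int N})) \<le> d * real N" using k(2) by simp
      then show ?case using N by (simp add: freq divide_le_eq)
    qed
    then have "upper_rel_density Npos A \<le> ereal d"
      unfolding upper_rel_density_def by (rule Limsup_bounded)
    then show False using d(2) by simp
  qed
qed

lemma has_rel_density_if_tendsto:
  assumes "(rel_freq E A \<longlongrightarrow> d) sequentially"
  shows "has_rel_density E A d"
  unfolding has_rel_density_def upper_rel_density_def lower_rel_density_def
  using assms by (auto intro!: lim_imp_Limsup lim_imp_Liminf)

text \<open>This passes from the integers of the definitions to the naturals of the sieve. With
  \<open>N \<ge> 2\<close> the denominators are nonzero.\<close>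

lemma rel_freq_primes_diff:
  assumes B: "B \<subseteq> {p. prime p}" and N: "N \<ge> 2"
  shows "rel_freq Primes (int ` ({p. prime p} - B)) N
    = 1 - real (card (B \<inter> {..N})) / real (prime_count N)"
proof -
  define P where "P = {p :: nat. prime p \<and> p \<le> N}"
  have finP: "finite P" by (simp add: P_def)
  have "2 \<in> P" using N by (simp add: P_def two_is_prime_nat)
  then have pos: "card P > 0" using finP card_gt_0_iff by blast
  have Primes: "Primes = int ` {p. prime p}"
  proof (intro equalityI subsetI)
    fix p assume "p \<in> Primes"
    then have "prime p" by (simp add: Primes_def)
    then have "p \<ge> 0" by (rule prime_ge_0_int)
    then obtain k where "p = int k" by (rule nonneg_int_cases)
    then show "p \<in> int ` {p. prime p}" using \<open>prime p\<close> by simp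
  qed (auto simp: Primes_def)
  have img: "int ` X \<inter> {1..int N} = int ` (X \<inter> {1..N})" for X :: "nat set"
  proof (intro equalityI subsetI)
    fix x assume "x \<in> int ` X \<inter> {1..int N}"
    then obtain k where "x = int k" "k \<in> X" "1 \<le> int k" "int k \<le> int N" by auto
    then show "x \<in> int ` (X \<inter> {1..N})" by simp
  qed auto
  have "Primes \<inter> {1..int N} = int ` P"
    unfolding Primes img P_def by (intro arg_cong[of _ _ "image int"]) (auto dest: prime_ge_1_nat)
  then have 1: "card (Primes \<inter> {1..int N}) = card P" by (simp add: card_image)
  have "int ` ({p. prime p} - B) \<inter> Primes \<inter> {1..int N} = int ` (P - B)"
  proof -
    have "int ` ({p. prime p} - B) \<inter> Primes = int ` ({p. prime p} - B)" unfolding Primes by auto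
    moreover have "({p. prime p} - B) \<inter> {1..N} = P - B" by (auto simp: P_def dest: prime_ge_1_nat)
    ultimately show ?thesis by (simp only: img)
  qed
  then have "card (int ` ({p. prime p} - B) \<inter> Primes \<inter> {1..int N}) = card (P - B)"
    by (simp add: card_image)
  also have "P - B = P - (B \<inter> {..N})" by (auto simp: P_def)
  also have "card \<dots> = card P - card (B \<inter> {..N})"
    using B by (intro card_Diff_subset) (auto simp: P_def)
  finally have 2: "card (int ` ({p. prime p} - B) \<inter> Primes \<inter> {1..int N}) = card P - card (B \<inter> {..N})" .
  have "card (B \<inter> {..N}) \<le> card P" using B finP by (intro card_mono) (auto simp: P_def)
  then have "rel_freq Primes (int ` ({p. prime p} - B)) N = (real (card P) - real (card (B \<inter> {..N}))) / real (card P)"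
    by (simp add: rel_freq_def 1 2 of_nat_diff)
  then show ?thesis using pos by (simp add: diff_divide_distrib prime_count_def flip: P_def)
qed

theorem theoremB:
  shows "\<exists>A R. A \<subseteq> Primes \<and> has_rel_density Primes A 1 \<and> \<not> syndetic (diff_set A A)
    \<and> R = Npos - diff_set A A \<and> thick R \<and> intersective R \<and> \<not> prime_intersective R"
proof -
  obtain m :: "nat \<Rightarrow> nat" where m:
    "\<And>e. e > 0 \<Longrightarrow> eventually (\<lambda>N. real (card ((\<Union>n. \<Union>h\<in>{m n<..m n + n}. prime_pairs h) \<inter> {..N}))
       \<le> e * real (prime_count N)) sequentially"
    using sparse_prime_pairs by blast
  define B where "B = (\<Union>n. \<Union>h\<in>{m n<..m n + n}. prime_pairs h)"
  define A where "A = int ` ({p. prime p} - B)"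
  define R where "R = Npos - diff_set A A"
  have B: "B \<subseteq> {p. prime p}" by (auto simp: B_def prime_pairs_def)
  have AP: "A \<subseteq> Primes" by (auto simp: A_def Primes_def)
  have "((\<lambda>N. real (card (B \<inter> {..N})) / real (prime_count N)) \<longlongrightarrow> 0) sequentially"
  proof (rule tendstoI)
    fix e :: real assume e: "e > 0"
    then have "e / 2 > 0" by simp
    from m[OF this] show "eventually (\<lambda>N. dist (real (card (B \<inter> {..N})) / real (prime_count N)) 0 < e) sequentially"
    proof eventually_elim
      case (elim N)
      then have "real (card (B \<inter> {..N})) / real (prime_count N) \<le> e / 2"
        using e by (cases "prime_count N = 0") (auto simp: B_def divide_le_eq)
      moreover have "e / 2 < e" using e by simp
      ultimately have "real (card (B \<inter> {..N})) / real (prime_count N) < e" by (rule le_less_trans)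
      then show ?case by simp
    qed
  qed
  then have "((\<lambda>N. 1 - real (card (B \<inter> {..N})) / real (prime_count N)) \<longlongrightarrow> 1 - 0) sequentially"
    by (intro tendsto_intros)
  moreover have "eventually (\<lambda>N. 1 - real (card (B \<inter> {..N})) / real (prime_count N) = rel_freq Primes A N) sequentially"
    using eventually_ge_at_top[of 2]
    by eventually_elim (simp add: A_def rel_freq_primes_diff[OF B])
  ultimately have "(rel_freq Primes A \<longlongrightarrow> 1) sequentially"
    using Lim_transform_eventually by fastforce
  then have dens: "has_rel_density Primes A 1" by (rule has_rel_density_if_tendsto)
  have thick: "thick R"
    unfolding thick_def
  proof
    fix n :: nat
    \<comment> \<open>The interval with index \<open>Suc n\<close> starts at \<open>k + 1\<close>
      and has \<open>n + 1\<close> elements, as many as thickness demands for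
      \<open>n\<close>.\<close>
    define k where "k = m (Suc n)"
    have "{int k + 1..int k + 1 + int n} \<subseteq> R \<inter> Npos"
    proof
      fix x assume x: "x \<in> {int k + 1..int k + 1 + int n}"
      define h where "h = nat x"
      have h: "x = int h" "h \<in> {k<..k + Suc n}" using x by (auto simp: h_def)
      \<comment> \<open>If \<open>x\<close> were a difference of two primes in \<open>A\<close>, the
        larger one would lie in some \<open>prime_pairs h\<close> that was removed.\<close>
      have "x \<notin> diff_set A A"
      proof
        assume "x \<in> diff_set A A"
        then obtain p q where pq: "prime p" "p \<notin> B" "prime q" "int h = int p - int q"
          by (auto simp: diff_set_def A_def h(1))
        have "p = q + h" using pq(4) by linarith
        then have "p \<in> prime_pairs h" using pq(1,3) by (simp add: prime_pairs_def)
        then have "p \<in> B" using h(2) unfolding B_def k_def by blast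
        with pq(2) show False by contradiction
      qed
      moreover have "x \<in> Npos" using x by (auto simp: Npos_def)
      ultimately show "x \<in> R \<inter> Npos" by (simp add: R_def)
    qed
    then show "\<exists>m. {m..m + int n} \<subseteq> R \<inter> Npos" by blast
  qed
  have "\<not> prime_intersective R"
  proof
    assume "prime_intersective R"
    moreover have "upper_rel_density Primes A > 0" using dens by (simp add: has_rel_density_def)
    ultimately have "R \<inter> diff_set A A \<noteq> {}"
      using AP by (simp add: prime_intersective_def intersective_wrt_def)
    then show False by (auto simp: R_def)
  qed
  moreover have "\<not> syndetic (diff_set A A)"
    using thick unfolding R_def by (rule not_syndetic_if_thick_complement)
  ultimately show ?thesis
    using AP dens thick intersective_if_thick[OF thick] R_def by blast
qed

end
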